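(* Fix an integer $n\geq 3$, and let $\mathbb{F}=\mathbb{R}$ or $\mathbb{F}=\mathbb{C}$. Let $f:\mathbb{F}\to\mathbb{F}$. Then the following are equivalent: (1) $f$ is a positive definite sign preserver on $M_n(\mathbb{F})$. (2) $f$ is a positive semidefinite sign preserver on $M_n(\mathbb{F})$. (3) $f$ is a positive multiple of a continuous field automorphism of $\mathbb{F}$; i.e., there is a real $c>0$ such that $f(x)=cx$ for all $x\in\mathbb{R}$ when $\mathbb{F}=\mathbb{R}$, and such that either $f(z)=cz$ for all $z\in\mathbb{C}$ or $f(z)=c\overline{z}$ for all $z\in\mathbb{C}$ when $\mathbb{F}=\mathbb{C}$.
   Context: $M_n(S)$ denotes the set of $n\times n$ matrices with entries in $S$. For a function $f$ and a matrix $A=(a_{ij})$, $f[A]:=(f(a_{ij}))$ is the entrywise action of $f$ on $A$. Positive definite and positive semidefinite matrices are Hermitian by definition (real symmetric when the entries are real). For $\Omega\subseteq\mathbb{C}$, a function $f:\Omega\to\mathbb{C}$ is a positive semidefinite (respectively positive definite) sign preserver on $M_n(\Omega)$ if, for every Hermitian matrix $A\in M_n(\Omega)$, $A$ is positive semidefinite (respectively positive definite) if and only if $f[A]$ is positive semidefinite (respectively positive definite). *)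

theory Defs
  imports "HOL-Analysis.Analysis" "Jordan_Normal_Form.Schur_Decomposition"
begin

text \<open>The classes \<open>conjugatable_field\<close> and \<open>conjugatable_ordered_field\<close> cover both real
  numbers (trivial conjugation) and complex numbers (conjugation \<open>cnj\<close>).  On complex numbers,
  \<open>z \<le> w\<close> means \<open>Re z \<le> Re w\<close> and \<open>Im z = Im w\<close>, so \<open>0 \<le> z\<close> and \<open>0 < z\<close> say that \<open>z\<close> is
  real and nonnegative, respectively positive.\<close>

definition hermitian :: "'a :: conjugatable_field mat \<Rightarrow> bool" where
  "hermitian A \<longleftrightarrow> mat_adjoint A = A"

definition positive_semidefinite :: "'a :: conjugatable_ordered_field mat \<Rightarrow> bool" where
  "positive_semidefinite A \<longleftrightarrow>
     hermitian A \<and> (\<forall>v \<in> carrier_vec (dim_row A). 0 \<le> (A *\<^sub>v v) \<bullet>c v)"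

definition positive_definite :: "'a :: conjugatable_ordered_field mat \<Rightarrow> bool" where
  "positive_definite A \<longleftrightarrow>
     hermitian A \<and>
     (\<forall>v \<in> carrier_vec (dim_row A). v \<noteq> 0\<^sub>v (dim_row A) \<longrightarrow> 0 < (A *\<^sub>v v) \<bullet>c v)"

text \<open>In the next two definitions \<open>f\<close> is total, but only its values on \<open>\<Omega>\<close> matter.\<close>

definition psd_sign_preserver ::
    "nat \<Rightarrow> 'a set \<Rightarrow> ('a \<Rightarrow> 'a :: conjugatable_ordered_field) \<Rightarrow> bool" where
  "psd_sign_preserver n \<Omega> f \<longleftrightarrow>
     (\<forall>A \<in> carrier_mat n n. elements_mat A \<subseteq> \<Omega> \<longrightarrow> hermitian A \<longrightarrow>
        (positive_semidefinite A \<longleftrightarrow> positive_semidefinite (map_mat f A)))"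

definition pd_sign_preserver ::
    "nat \<Rightarrow> 'a set \<Rightarrow> ('a \<Rightarrow> 'a :: conjugatable_ordered_field) \<Rightarrow> bool" where
  "pd_sign_preserver n \<Omega> f \<longleftrightarrow>
     (\<forall>A \<in> carrier_mat n n. elements_mat A \<subseteq> \<Omega> \<longrightarrow> hermitian A \<longrightarrow>
        (positive_definite A \<longleftrightarrow> positive_definite (map_mat f A)))"

definition continuous_field_automorphism :: "('a :: real_normed_field \<Rightarrow> 'a) \<Rightarrow> bool" where
  "continuous_field_automorphism \<sigma> \<longleftrightarrow> field_hom \<sigma> \<and> bij \<sigma> \<and> continuous_on UNIV \<sigma>"

definition positive_multiple_of_continuous_automorphism ::
    "('a :: real_normed_field \<Rightarrow> 'a) \<Rightarrow> bool" where
  "positive_multiple_of_continuous_automorphism f \<longleftrightarrow>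
     (\<exists>c::real. c > 0 \<and> (\<exists>\<sigma>. continuous_field_automorphism \<sigma> \<and> (\<forall>x. f x = c *\<^sub>R \<sigma> x)))"

end

theory Submission
  imports Defs
begin

unbundle no vec_syntax

text \<open>Both kinds of preserver send positive definite matrices to positive semidefinite ones, and
  a matrix whose image is positive definite is positive semidefinite. The matrices
  \<open>(a - b) I + b J\<close> show that the preserver \<open>g\<close> is positive and strictly increasing on the positive
  reals; repeating an index then reduces the problem to \<open>3 \<times> 3\<close> matrices, where positivity is
  read off from the sign of the determinant. Three families of such matrices suffice. Repeated
  indices give \<open>|z|\<^sup>2 < a c \<Longrightarrow> |g z|\<^sup>2 \<le> g a g c\<close> and its converse, whence \<open>g 0 = 0\<close>. The matrices
  \<open>[[p, 0, p], [0, q, q], [p, q, s]]\<close>, of determinant \<open>p q (s - p - q)\<close>, make \<open>g\<close> additive and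
  hence linear on the positive reals, with a factor \<open>c\<close>, and then \<open>|g z| = c |z|\<close>. Finally, the
  determinant of \<open>[[s, z, x], [cnj z, s, w], [x, cnj w, s]]\<close> depends on the arguments of \<open>z\<close> and
  \<open>w\<close> only through \<open>Re (z w)\<close>, so \<open>Re (g z g w) = c\<^sup>2 Re (z w)\<close>; taking \<open>w = 1\<close> and \<open>w = \<i>\<close>
  determines \<open>g\<close>.\<close>

section \<open>Matrices as functions of two indices\<close>

text \<open>Matrices are represented by functions \<open>nat \<Rightarrow> nat \<Rightarrow> complex\<close>, of which only the values at
  indices below \<open>n\<close> matter. A real function \<open>f\<close> becomes \<open>\<lambda>z. of_real (f (Re z))\<close>, acting on
  matrices with entries in \<open>\<real>\<close>.\<close>

definition hform :: "nat \<Rightarrow> (nat \<Rightarrow> nat \<Rightarrow> 'a :: conjugatable_field) \<Rightarrow> (nat \<Rightarrow> 'a) \<Rightarrow> 'a" where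
  "hform n M v = (\<Sum>i<n. \<Sum>j<n. M i j * v j * conjugate (v i))"

definition hermitian_kernel :: "nat \<Rightarrow> (nat \<Rightarrow> nat \<Rightarrow> complex) \<Rightarrow> bool" where
  "hermitian_kernel n M \<longleftrightarrow> (\<forall>i<n. \<forall>j<n. M j i = cnj (M i j))"

definition psd_kernel :: "nat \<Rightarrow> (nat \<Rightarrow> nat \<Rightarrow> complex) \<Rightarrow> bool" where
  "psd_kernel n M \<longleftrightarrow> hermitian_kernel n M \<and> (\<forall>v. 0 \<le> Re (hform n M v))"

definition pd_kernel :: "nat \<Rightarrow> (nat \<Rightarrow> nat \<Rightarrow> complex) \<Rightarrow> bool" where
  "pd_kernel n M \<longleftrightarrow>
     hermitian_kernel n M \<and> (\<forall>v. (\<exists>i<n. v i \<noteq> 0) \<longrightarrow> 0 < Re (hform n M v))"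

lemma hermitian_kernelD: "hermitian_kernel n M \<Longrightarrow> i < n \<Longrightarrow> j < n \<Longrightarrow> M j i = cnj (M i j)"
  unfolding hermitian_kernel_def by blast

lemma hform_cong:
  assumes "\<And>i j. i < n \<Longrightarrow> j < n \<Longrightarrow> M i j = N i j" "\<And>i. i < n \<Longrightarrow> v i = w i"
  shows "hform n M v = hform n N w"
  unfolding hform_def by (intro sum.cong refl) (auto simp: assms)

section \<open>Translation of matrix positivity into kernels\<close>

lemma scalar_prod_hform:
  assumes A: "A \<in> carrier_mat n n" and v: "v \<in> carrier_vec n"
  shows "(A *\<^sub>v v) \<bullet>c v = hform n (\<lambda>i j. A $$ (i, j)) (\<lambda>i. v $ i)"
  using A v by (simp add: scalar_prod_def hform_def sum_distrib_right atLeast0LessThan)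

lemma hermitian_iff:
  assumes A: "A \<in> carrier_mat n n"
  shows "hermitian A \<longleftrightarrow> (\<forall>i<n. \<forall>j<n. A $$ (j, i) = conjugate (A $$ (i, j)))"
proof -
  have carrier: "mat_adjoint A \<in> carrier_mat n n"
    and adj: "\<And>i j. i < n \<Longrightarrow> j < n \<Longrightarrow> mat_adjoint A $$ (j, i) = conjugate (A $$ (i, j))"
    using A by (auto simp: mat_adjoint_def mat_of_rows_def)
  have "hermitian A \<longleftrightarrow> (\<forall>i<n. \<forall>j<n. mat_adjoint A $$ (j, i) = A $$ (j, i))"
    using A carrier unfolding hermitian_def by (auto intro!: eq_matI)
  also have "\<dots> \<longleftrightarrow> (\<forall>i<n. \<forall>j<n. A $$ (j, i) = conjugate (A $$ (i, j)))"
    using adj by metis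
  finally show ?thesis .
qed

lemma positive_semidefinite_iff:
  fixes A :: "'a :: conjugatable_ordered_field mat"
  assumes A: "A \<in> carrier_mat n n"
  shows "positive_semidefinite A \<longleftrightarrow>
    (\<forall>i<n. \<forall>j<n. A $$ (j, i) = conjugate (A $$ (i, j))) \<and>
    (\<forall>v. 0 \<le> hform n (\<lambda>i j. A $$ (i, j)) v)"
proof -
  have "(\<forall>v \<in> carrier_vec n. 0 \<le> (A *\<^sub>v v) \<bullet>c v) \<longleftrightarrow>
        (\<forall>v. 0 \<le> hform n (\<lambda>i j. A $$ (i, j)) v)" (is "?L \<longleftrightarrow> ?R")
  proof
    assume L: ?L
    show ?R
    proof
      fix v :: "nat \<Rightarrow> 'a"
      have "hform n (\<lambda>i j. A $$ (i, j)) v = (A *\<^sub>v vec n v) \<bullet>c vec n v"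
        unfolding scalar_prod_hform[OF A vec_carrier] by (rule hform_cong) auto
      then show "0 \<le> hform n (\<lambda>i j. A $$ (i, j)) v" using L by auto
    qed
  qed (simp add: scalar_prod_hform[OF A])
  then show ?thesis
    using A by (simp add: positive_semidefinite_def hermitian_iff[OF A])
qed

lemma positive_definite_iff:
  fixes A :: "'a :: conjugatable_ordered_field mat"
  assumes A: "A \<in> carrier_mat n n"
  shows "positive_definite A \<longleftrightarrow>
    (\<forall>i<n. \<forall>j<n. A $$ (j, i) = conjugate (A $$ (i, j))) \<and>
    (\<forall>v. (\<exists>i<n. v i \<noteq> 0) \<longrightarrow> 0 < hform n (\<lambda>i j. A $$ (i, j)) v)"
proof -
  have "(\<forall>v \<in> carrier_vec n. v \<noteq> 0\<^sub>v n \<longrightarrow> 0 < (A *\<^sub>v v) \<bullet>c v) \<longleftrightarrow>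
        (\<forall>v. (\<exists>i<n. v i \<noteq> 0) \<longrightarrow> 0 < hform n (\<lambda>i j. A $$ (i, j)) v)" (is "?L \<longleftrightarrow> ?R")
  proof
    assume L: ?L
    show ?R
    proof (intro allI impI)
      fix v :: "nat \<Rightarrow> 'a"
      assume "\<exists>i<n. v i \<noteq> 0"
      then have "vec n v \<noteq> 0\<^sub>v n" by (auto simp: vec_eq_iff)
      moreover have "hform n (\<lambda>i j. A $$ (i, j)) v = (A *\<^sub>v vec n v) \<bullet>c vec n v"
        unfolding scalar_prod_hform[OF A vec_carrier] by (rule hform_cong) auto
      ultimately show "0 < hform n (\<lambda>i j. A $$ (i, j)) v" using L by auto
    qed
  next
    assume R: ?R
    show ?L
    proof (intro ballI impI)
      fix v :: "'a Matrix.vec" assume v: "v \<in> carrier_vec n" "v \<noteq> 0\<^sub>v n"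
      then have "\<exists>i<n. v $ i \<noteq> 0" by (auto simp: vec_eq_iff)
      then show "0 < (A *\<^sub>v v) \<bullet>c v" using R v by (simp add: scalar_prod_hform[OF A])
    qed
  qed
  then show ?thesis
    using A by (simp add: positive_definite_def hermitian_iff[OF A])
qed

text \<open>Conjugating the form only exchanges its two summation indices. Hence the order on
  complex numbers, which also compares imaginary parts, reduces to the sign of the real
  part.\<close>

lemma Im_hform_hermitian:
  assumes "hermitian_kernel n M"
  shows "Im (hform n M v) = 0"
proof -
  have "\<And>i j. i < n \<Longrightarrow> j < n \<Longrightarrow> cnj (M i j) = M j i"
    using hermitian_kernelD[OF assms] by metis
  then have "cnj (hform n M v) = (\<Sum>i<n. \<Sum>j<n. M j i * v i * cnj (v j))"
    unfolding hform_def cnj_sum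
    by (intro sum.cong refl) (simp add: mult_ac)
  also have "\<dots> = hform n M v"
    unfolding hform_def by (subst sum.swap) simp
  finally show ?thesis by (simp add: complex_eq_iff)
qed

lemma positive_semidefinite_complex:
  assumes "A \<in> carrier_mat n n"
  shows "positive_semidefinite A \<longleftrightarrow> psd_kernel n (\<lambda>i j. A $$ (i, j))"
  unfolding positive_semidefinite_iff[OF assms] psd_kernel_def conjugate_complex_def
    hermitian_kernel_def[symmetric]
  by (auto simp: Im_hform_hermitian less_eq_complex_def)

lemma positive_definite_complex:
  assumes "A \<in> carrier_mat n n"
  shows "positive_definite A \<longleftrightarrow> pd_kernel n (\<lambda>i j. A $$ (i, j))"
  unfolding positive_definite_iff[OF assms] pd_kernel_def conjugate_complex_def
    hermitian_kernel_def[symmetric]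
  by (auto simp: Im_hform_hermitian less_complex_def)

text \<open>For real entries, products mixing a real with an imaginary part of \<open>v\<close>
  enter only the imaginary part of the form, so complex test vectors impose nothing beyond real
  ones.\<close>

lemma Re_hform_of_real:
  "Re (hform n (\<lambda>i j. complex_of_real (M i j)) v) =
    hform n M (\<lambda>i. Re (v i)) + hform n M (\<lambda>i. Im (v i))"
  unfolding hform_def Re_sum sum.distrib[symmetric]
  by (intro sum.cong refl) (simp add: algebra_simps)

lemma positive_semidefinite_real:
  assumes "A \<in> carrier_mat n n"
  shows "positive_semidefinite A \<longleftrightarrow> psd_kernel n (\<lambda>i j. complex_of_real (A $$ (i, j)))"
proof -
  have "(\<forall>v. 0 \<le> hform n (\<lambda>i j. A $$ (i, j)) v) \<longleftrightarrow>
    (\<forall>v. 0 \<le> Re (hform n (\<lambda>i j. complex_of_real (A $$ (i, j))) v))" (is "?L \<longleftrightarrow> ?R")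
  proof
    assume R: ?R
    show ?L
    proof
      fix v show "0 \<le> hform n (\<lambda>i j. A $$ (i, j)) v"
        using R[rule_format, of "\<lambda>i. of_real (v i)"] unfolding Re_hform_of_real
        by (simp add: hform_def)
    qed
  qed (simp add: Re_hform_of_real)
  then show ?thesis
    by (simp add: positive_semidefinite_iff[OF assms] psd_kernel_def hermitian_kernel_def)
qed

lemma positive_definite_real:
  assumes "A \<in> carrier_mat n n"
  shows "positive_definite A \<longleftrightarrow> pd_kernel n (\<lambda>i j. complex_of_real (A $$ (i, j)))"
proof -
  have "(\<forall>v. (\<exists>i<n. v i \<noteq> 0) \<longrightarrow> 0 < hform n (\<lambda>i j. A $$ (i, j)) v) \<longleftrightarrow>
    (\<forall>v. (\<exists>i<n. v i \<noteq> 0) \<longrightarrow> 0 < Re (hform n (\<lambda>i j. complex_of_real (A $$ (i, j))) v))"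
    (is "?L \<longleftrightarrow> ?R")
  proof
    assume L: ?L
    \<comment> \<open>A nonzero complex vector may have vanishing real or imaginary part, so one of
      the two summands is only nonnegative.\<close>
    have nonneg: "0 \<le> hform n (\<lambda>i j. A $$ (i, j)) v" for v
    proof (cases "\<exists>i<n. v i \<noteq> 0")
      case False
      then show ?thesis by (simp add: hform_def)
    qed (use L in \<open>auto intro: less_imp_le\<close>)
    show ?R
    proof (intro allI impI)
      fix v :: "nat \<Rightarrow> complex" assume "\<exists>i<n. v i \<noteq> 0"
      then have "(\<exists>i<n. Re (v i) \<noteq> 0) \<or> (\<exists>i<n. Im (v i) \<noteq> 0)"
        by (auto simp: complex_eq_iff)
      then show "0 < Re (hform n (\<lambda>i j. complex_of_real (A $$ (i, j))) v)"
        unfolding Re_hform_of_real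
        using L nonneg by (metis add_nonneg_pos add_pos_nonneg)
    qed
  next
    assume R: ?R
    show ?L
    proof (intro allI impI)
      fix v :: "nat \<Rightarrow> real" assume "\<exists>i<n. v i \<noteq> 0"
      then show "0 < hform n (\<lambda>i j. A $$ (i, j)) v"
        using R[rule_format, of "\<lambda>i. of_real (v i)"] unfolding Re_hform_of_real
        by (simp add: hform_def)
    qed
  qed
  then show ?thesis
    by (simp add: positive_definite_iff[OF assms] pd_kernel_def hermitian_kernel_def)
qed

text \<open>\<open>P\<close> stands for \<open>psd_kernel\<close> or \<open>pd_kernel\<close>, so
  that both cases share the later arguments; \<open>\<Omega>\<close> is \<open>UNIV\<close> for
  complex functions and \<open>\<real>\<close> for real ones.\<close>

definition sign_preserver ::
    "(nat \<Rightarrow> (nat \<Rightarrow> nat \<Rightarrow> complex) \<Rightarrow> bool) \<Rightarrow> nat \<Rightarrow> complex set \<Rightarrow> (complex \<Rightarrow> complex) \<Rightarrow> bool" where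
  "sign_preserver P n \<Omega> g \<longleftrightarrow>
     (\<forall>M. (\<forall>i<n. \<forall>j<n. M i j \<in> \<Omega>) \<longrightarrow> hermitian_kernel n M \<longrightarrow>
        (P n M \<longleftrightarrow> P n (\<lambda>i j. g (M i j))))"

lemma kernel_cong:
  assumes "\<And>i j. i < n \<Longrightarrow> j < n \<Longrightarrow> M i j = N i j"
  shows "hermitian_kernel n M = hermitian_kernel n N"
    and "psd_kernel n M = psd_kernel n N" and "pd_kernel n M = pd_kernel n N"
proof -
  show "hermitian_kernel n M = hermitian_kernel n N"
    using assms by (simp add: hermitian_kernel_def)
  moreover have "hform n M v = hform n N v" for v
    by (rule hform_cong) (use assms in auto)
  ultimately show "psd_kernel n M = psd_kernel n N" "pd_kernel n M = pd_kernel n N"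
    by (simp_all add: psd_kernel_def pd_kernel_def)
qed

lemma positive_mat_complex:
  "positive_semidefinite (Matrix.mat n n (\<lambda>(i, j). M i j)) \<longleftrightarrow> psd_kernel n M"
  "positive_definite (Matrix.mat n n (\<lambda>(i, j). M i j)) \<longleftrightarrow> pd_kernel n M"
  by (subst positive_semidefinite_complex[OF mat_carrier], rule kernel_cong, simp)
    (subst positive_definite_complex[OF mat_carrier], rule kernel_cong, simp)

lemma positive_mat_real:
  "positive_semidefinite (Matrix.mat n n (\<lambda>(i, j). M i j)) \<longleftrightarrow>
     psd_kernel n (\<lambda>i j. complex_of_real (M i j))"
  "positive_definite (Matrix.mat n n (\<lambda>(i, j). M i j)) \<longleftrightarrow>
     pd_kernel n (\<lambda>i j. complex_of_real (M i j))"
  by (subst positive_semidefinite_real[OF mat_carrier], rule kernel_cong, simp)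
    (subst positive_definite_real[OF mat_carrier], rule kernel_cong, simp)

lemma map_mat_mat:
  "map_mat f (Matrix.mat n m (\<lambda>(i, j). M i j)) = Matrix.mat n m (\<lambda>(i, j). f (M i j))"
  by (rule eq_matI) auto

lemma hermitian_mat:
  "hermitian (Matrix.mat n n (\<lambda>(i, j). M i j)) \<longleftrightarrow>
     (\<forall>i<n. \<forall>j<n. M j i = conjugate (M i j))"
  by (subst hermitian_iff[of _ n]) auto

lemma psd_sign_preserver_complex:
  assumes "psd_sign_preserver n UNIV g"
  shows "sign_preserver psd_kernel n UNIV g"
  unfolding sign_preserver_def
proof (intro allI impI)
  fix M assume "hermitian_kernel n M"
  then have "hermitian (Matrix.mat n n (\<lambda>(i, j). M i j))"
    unfolding hermitian_mat hermitian_kernel_def conjugate_complex_def .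
  then have "positive_semidefinite (Matrix.mat n n (\<lambda>(i, j). M i j)) \<longleftrightarrow>
      positive_semidefinite (map_mat g (Matrix.mat n n (\<lambda>(i, j). M i j)))"
    using assms mat_carrier unfolding psd_sign_preserver_def by blast
  then show "psd_kernel n M \<longleftrightarrow> psd_kernel n (\<lambda>i j. g (M i j))"
    unfolding map_mat_mat positive_mat_complex by simp
qed

lemma pd_sign_preserver_complex:
  assumes "pd_sign_preserver n UNIV g"
  shows "sign_preserver pd_kernel n UNIV g"
  unfolding sign_preserver_def
proof (intro allI impI)
  fix M assume "hermitian_kernel n M"
  then have "hermitian (Matrix.mat n n (\<lambda>(i, j). M i j))"
    unfolding hermitian_mat hermitian_kernel_def conjugate_complex_def .
  then have "positive_definite (Matrix.mat n n (\<lambda>(i, j). M i j)) \<longleftrightarrow>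
      positive_definite (map_mat g (Matrix.mat n n (\<lambda>(i, j). M i j)))"
    using assms mat_carrier unfolding pd_sign_preserver_def by blast
  then show "pd_kernel n M \<longleftrightarrow> pd_kernel n (\<lambda>i j. g (M i j))"
    unfolding map_mat_mat positive_mat_complex by simp
qed

lemma hermitian_mat_Re:
  assumes "hermitian_kernel n M"
  shows "hermitian (Matrix.mat n n (\<lambda>(i, j). Re (M i j)))"
  using assms unfolding hermitian_mat hermitian_kernel_def conjugate_real_def by (metis cnj.simps(1))

lemma psd_sign_preserver_real:
  assumes "psd_sign_preserver n UNIV f"
  shows "sign_preserver psd_kernel n \<real> (\<lambda>z. of_real (f (Re z)))"
  unfolding sign_preserver_def
proof (intro allI impI)
  fix M assume M: "\<forall>i<n. \<forall>j<n. M i j \<in> \<real>" and "hermitian_kernel n M"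
  then have "hermitian (Matrix.mat n n (\<lambda>(i, j). Re (M i j)))"
    by (intro hermitian_mat_Re)
  then have "positive_semidefinite (Matrix.mat n n (\<lambda>(i, j). Re (M i j))) \<longleftrightarrow>
      positive_semidefinite (map_mat f (Matrix.mat n n (\<lambda>(i, j). Re (M i j))))"
    using assms mat_carrier unfolding psd_sign_preserver_def by blast
  moreover have "psd_kernel n M = psd_kernel n (\<lambda>i j. of_real (Re (M i j)))"
    by (rule kernel_cong) (use M in auto)
  ultimately show "psd_kernel n M \<longleftrightarrow> psd_kernel n (\<lambda>i j. of_real (f (Re (M i j))))"
    unfolding map_mat_mat positive_mat_real by simp
qed

lemma pd_sign_preserver_real:
  assumes "pd_sign_preserver n UNIV f"
  shows "sign_preserver pd_kernel n \<real> (\<lambda>z. of_real (f (Re z)))"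
  unfolding sign_preserver_def
proof (intro allI impI)
  fix M assume M: "\<forall>i<n. \<forall>j<n. M i j \<in> \<real>" and "hermitian_kernel n M"
  then have "hermitian (Matrix.mat n n (\<lambda>(i, j). Re (M i j)))"
    by (intro hermitian_mat_Re)
  then have "positive_definite (Matrix.mat n n (\<lambda>(i, j). Re (M i j))) \<longleftrightarrow>
      positive_definite (map_mat f (Matrix.mat n n (\<lambda>(i, j). Re (M i j))))"
    using assms mat_carrier unfolding pd_sign_preserver_def by blast
  moreover have "pd_kernel n M = pd_kernel n (\<lambda>i j. of_real (Re (M i j)))"
    by (rule kernel_cong) (use M in auto)
  ultimately show "pd_kernel n M \<longleftrightarrow> pd_kernel n (\<lambda>i j. of_real (f (Re (M i j))))"
    unfolding map_mat_mat positive_mat_real by simp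
qed

section \<open>Determinants of order three\<close>

text \<open>The determinant of the Hermitian matrix with rows \<open>[a, x, y]\<close>,
  \<open>[cnj x, b, z]\<close>, \<open>[cnj y, cnj z, c]\<close>.\<close>

definition det3 :: "real \<Rightarrow> real \<Rightarrow> real \<Rightarrow> complex \<Rightarrow> complex \<Rightarrow> complex \<Rightarrow> real" where
  "det3 a b c x y z =
     a * b * c + 2 * Re (x * z * cnj y) - a * (cmod z)\<^sup>2 - b * (cmod y)\<^sup>2 - c * (cmod x)\<^sup>2"

text \<open>Subtracting the second row and column from the first splits off the entry
  \<open>d\<close> and leaves the 2 x 2 matrix with diagonal \<open>c\<close>, \<open>a\<close> and
  off-diagonal entry \<open>z\<close>.\<close>

lemma det3_repeated_index:
  "det3 (c + d) c a (of_real c) z z = d * (a * c - (cmod z)\<^sup>2)"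
  unfolding det3_def cmod_power2 by (simp add: algebra_simps power2_eq_square)

text \<open>For nonzero \<open>p\<close> and \<open>q\<close> the last factor is the Schur
  complement of the diagonal block; it compares \<open>s\<close> with \<open>p + q\<close>.\<close>

lemma det3_arrow:
  "det3 p q s 0 (of_real p) (of_real q) = p * q * (s - p - q)"
  unfolding det3_def by (simp add: algebra_simps power2_eq_square)

lemma det3_constant_diagonal:
  "det3 s s s z (of_real x) w = s ^ 3 + 2 * x * Re (z * w) - s * ((cmod z)\<^sup>2 + x\<^sup>2 + (cmod w)\<^sup>2)"
  unfolding det3_def cmod_power2 by (simp add: algebra_simps power2_eq_square power3_eq_cube)

text \<open>All that the classification uses of a preserver. The two bounds on \<open>x\<close> and
  \<open>g x\<close> keep the leading minors of the matrix and of its image positive, so that the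
  determinants decide. The conclusions are weak inequalities because semidefiniteness of the image
  is what both kinds of preservation have in common.\<close>

locale det3_sign_preserver =
  fixes \<Omega> :: "complex set" and g :: "complex \<Rightarrow> complex" and \<phi> :: "real \<Rightarrow> real"
  assumes Reals_subset: "\<real> \<subseteq> \<Omega>"
    and g_of_real: "t > 0 \<Longrightarrow> g (of_real t) = of_real (\<phi> t)"
    and pos: "t > 0 \<Longrightarrow> \<phi> t > 0"
    and strict_increasing: "0 < s \<Longrightarrow> s < t \<Longrightarrow> \<phi> s < \<phi> t"
    and det3_pos: "\<lbrakk>a > 0; b > 0; c > 0; x \<in> \<Omega>; y \<in> \<Omega>; z \<in> \<Omega>; (cmod x)\<^sup>2 < a * b;
      (cmod (g x))\<^sup>2 < \<phi> a * \<phi> b; det3 a b c x y z > 0\<rbrakk> \<Longrightarrow>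
      det3 (\<phi> a) (\<phi> b) (\<phi> c) (g x) (g y) (g z) \<ge> 0"
    and det3_neg: "\<lbrakk>a > 0; b > 0; c > 0; x \<in> \<Omega>; y \<in> \<Omega>; z \<in> \<Omega>; (cmod x)\<^sup>2 < a * b;
      (cmod (g x))\<^sup>2 < \<phi> a * \<phi> b; det3 a b c x y z < 0\<rbrakk> \<Longrightarrow>
      det3 (\<phi> a) (\<phi> b) (\<phi> c) (g x) (g y) (g z) \<le> 0"
begin

section \<open>Linearity on the positive reals\<close>

lemma of_real_mem [simp]: "of_real t \<in> \<Omega>"
  using Reals_subset by auto

lemma increasing: "0 < s \<Longrightarrow> s \<le> t \<Longrightarrow> \<phi> s \<le> \<phi> t"
  using strict_increasing[of s t] by (cases "s = t") auto

text \<open>The index of \<open>c\<close> in the \<open>2 \<times> 2\<close> block is repeated, with the new diagonal entry raised to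
  \<open>c + 1\<close>: this multiplies the determinant by the increment, for the matrix and for its image.\<close>

lemma two_by_two:
  assumes "a > 0" "c > 0" "z \<in> \<Omega>"
  shows "(cmod z)\<^sup>2 < a * c \<Longrightarrow> (cmod (g z))\<^sup>2 \<le> \<phi> a * \<phi> c"
    and "a * c < (cmod z)\<^sup>2 \<Longrightarrow> \<phi> a * \<phi> c \<le> (cmod (g z))\<^sup>2"
proof -
  define d where "d = \<phi> (c + 1) - \<phi> c"
  have d: "d > 0" and \<phi>: "\<phi> (c + 1) = \<phi> c + d"
    using strict_increasing[of c "c + 1"] assms by (simp_all add: d_def)
  have minor: "(cmod (of_real c))\<^sup>2 < (c + 1) * c"
    "(cmod (g (of_real c)))\<^sup>2 < \<phi> (c + 1) * \<phi> c"
    using assms d pos[of c] unfolding \<phi>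
    by (simp_all add: g_of_real power2_eq_square algebra_simps)
  note pos' = det3_pos[of "c + 1" c a "of_real c" z z, unfolded det3_repeated_index \<phi>]
  note neg' = det3_neg[of "c + 1" c a "of_real c" z z, unfolded det3_repeated_index \<phi>]
  show "(cmod (g z))\<^sup>2 \<le> \<phi> a * \<phi> c" if "(cmod z)\<^sup>2 < a * c"
    using pos' assms minor that d
    by (simp add: g_of_real det3_repeated_index \<phi> zero_le_mult_iff)
  show "\<phi> a * \<phi> c \<le> (cmod (g z))\<^sup>2" if "a * c < (cmod z)\<^sup>2"
    using neg' assms minor that d
    by (simp add: g_of_real det3_repeated_index \<phi> mult_le_0_iff)
qed

text \<open>If the infimum \<open>m\<close> of the values were positive, \<open>two_by_two\<close>
  would give \<open>m * \<phi> 1 \<le> (\<phi> b)\<^sup>2\<close> for every \<open>b > 0\<close>.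
  Values \<open>\<phi> b\<close> close to \<open>m\<close> contradict this, since
  \<open>m < \<phi> 1\<close>.\<close>

lemma arbitrarily_small:
  assumes "e > 0"
  shows "\<exists>t>0. \<phi> t < e"
proof (rule ccontr)
  assume "\<not> ?thesis"
  then have e: "e \<le> \<phi> t" if "t > 0" for t
    using that by (metis not_less)
  define m where "m = Inf (\<phi> ` {0<..})"
  have bdd: "bdd_below (\<phi> ` {0<..})"
    using e by (auto intro!: bdd_belowI)
  have m_le: "m \<le> \<phi> t" if "t > 0" for t
    unfolding m_def using that bdd by (intro cInf_lower) auto
  have "e \<le> m"
    unfolding m_def using e by (intro cInf_greatest) auto
  then have m: "m > 0" using assms by simp
  have bound: "m * \<phi> 1 \<le> (\<phi> b)\<^sup>2" if "b > 0" for b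
  proof -
    \<comment> \<open>Halving gives the strict inequality
      \<open>b\<^sup>2 / 2 * 1 < b\<^sup>2\<close> that \<open>two_by_two\<close> requires.\<close>
    have "\<phi> (b\<^sup>2 / 2) * \<phi> 1 \<le> (\<phi> b)\<^sup>2"
      using two_by_two(2)[of "b\<^sup>2 / 2" 1 "of_real b"] that pos[of b] by (simp add: g_of_real)
    moreover have "m * \<phi> 1 \<le> \<phi> (b\<^sup>2 / 2) * \<phi> 1"
      using m_le[of "b\<^sup>2 / 2"] pos[of 1] that by (intro mult_right_mono) auto
    ultimately show ?thesis by linarith
  qed
  have "m < \<phi> 1"
    using m_le[of "1/2"] strict_increasing[of "1/2" 1] by simp
  then have "m\<^sup>2 < m * \<phi> 1"
    using m by (simp add: power2_eq_square)
  then have "m < sqrt (m * \<phi> 1)"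
    by (rule real_less_rsqrt)
  then have "\<exists>y\<in>\<phi> ` {0<..}. y < sqrt (m * \<phi> 1)"
    unfolding m_def by (intro cInf_lessD) auto
  then obtain b where b: "b > 0" "\<phi> b < sqrt (m * \<phi> 1)" by auto
  then have "(\<phi> b)\<^sup>2 < (sqrt (m * \<phi> 1))\<^sup>2"
    using pos[of b] by (intro power_strict_mono) auto
  then show False
    using bound[OF b(1)] m pos[of 1] by simp
qed

text \<open>With diagonal entries \<open>t\<close> and off-diagonal entry 0,
  \<open>two_by_two\<close> bounds \<open>cmod (g 0)\<close> by \<open>\<phi> t\<close>, which can
  be made arbitrarily small.\<close>

lemma g_0: "g 0 = 0"
proof (rule ccontr)
  assume "g 0 \<noteq> 0"
  then obtain t where t: "t > 0" "\<phi> t < cmod (g 0)"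
    using arbitrarily_small[of "cmod (g 0)"] by auto
  then have "(\<phi> t)\<^sup>2 < (cmod (g 0))\<^sup>2"
    using pos[of t] by (intro power_strict_mono) auto
  moreover have "(cmod (g 0))\<^sup>2 \<le> \<phi> t * \<phi> t"
    using two_by_two(1)[of t t 0] t of_real_mem[of 0] by simp
  ultimately show False by (simp add: power2_eq_square)
qed

text \<open>Because \<open>g 0 = 0\<close>, the matrix of \<open>det3_arrow\<close> goes to one of
  the same shape in \<open>\<phi> p\<close>, \<open>\<phi> q\<close>, \<open>\<phi> s\<close>. At
  \<open>s = p + q\<close> the determinant vanishes and the locale assumptions are silent.\<close>

lemma almost_additive:
  assumes "p > 0" "q > 0" "s > 0"
  shows "p + q < s \<Longrightarrow> \<phi> p + \<phi> q \<le> \<phi> s" and "s < p + q \<Longrightarrow> \<phi> s \<le> \<phi> p + \<phi> q"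
proof -
  have pq: "\<phi> p * \<phi> q > 0" "p * q > 0" using pos assms by simp_all
  have 0: "0 \<in> \<Omega>" using of_real_mem[of 0] by simp
  show "\<phi> p + \<phi> q \<le> \<phi> s" if "p + q < s"
    using det3_pos[of p q s 0 "of_real p" "of_real q"] pq 0 assms that
    by (simp add: g_0 g_of_real det3_arrow zero_le_mult_iff)
  show "\<phi> s \<le> \<phi> p + \<phi> q" if "s < p + q"
    using det3_neg[of p q s 0 "of_real p" "of_real q"] pq 0 assms that pos[of p] pos[of q]
    by (simp add: g_0 g_of_real det3_arrow mult_le_0_iff mult_less_0_iff)
qed

lemma additive:
  assumes "p > 0" "q > 0"
  shows "\<phi> (p + q) = \<phi> p + \<phi> q"
proof (rule antisym)
  show "\<phi> (p + q) \<le> \<phi> p + \<phi> q"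
  proof (rule field_le_epsilon)
    fix e :: real assume "e > 0"
    then obtain t where "t > 0" "\<phi> t < e" using arbitrarily_small by blast
    \<comment> \<open>The shift by \<open>t / 2\<close> makes both comparisons strict:
      \<open>p + q < (p + t / 2) + q\<close> and \<open>p + t / 2 < p + t\<close>. The resulting
      error is \<open>\<phi> t < e\<close>.\<close>
    then show "\<phi> (p + q) \<le> \<phi> p + \<phi> q + e"
      using almost_additive(2)[of "p + t / 2" q "p + q"] almost_additive(2)[of p t "p + t / 2"] assms
      by simp
  qed
  show "\<phi> p + \<phi> q \<le> \<phi> (p + q)"
  proof (rule field_le_epsilon)
    fix e :: real assume "e > 0"
    then obtain t where "t > 0" "\<phi> t < e" using arbitrarily_small by blast
    then show "\<phi> p + \<phi> q \<le> \<phi> (p + q) + e"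
      using almost_additive(1)[of p q "p + q + t / 2"]
        almost_additive(2)[of "p + q" t "p + q + t / 2"] assms
      by simp
  qed
qed

lemma of_nat_mult:
  assumes "t > 0" "k > 0"
  shows "\<phi> (of_nat k * t) = of_nat k * \<phi> t"
  using assms(2)
proof (induction k rule: nat_induct_non_zero)
  case (Suc k)
  have "\<phi> (of_nat (Suc k) * t) = \<phi> (of_nat k * t + t)" by (simp add: algebra_simps)
  also have "\<dots> = \<phi> (of_nat k * t) + \<phi> t" using Suc.hyps assms by (intro additive) simp_all
  finally show ?case using Suc.IH by (simp add: algebra_simps)
qed simp

text \<open>An additive increasing function is linear: enclosing \<open>N * t\<close> between
  consecutive integers bounds \<open>N * \<bar>\<phi> t - \<phi> 1 * t\<bar>\<close> by
  \<open>\<phi> 1\<close>, which fails for large \<open>N\<close> unless the difference is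
  zero.\<close>

lemma linear:
  assumes t: "t > 0"
  shows "\<phi> t = \<phi> 1 * t"
proof (rule ccontr)
  assume "\<phi> t \<noteq> \<phi> 1 * t"
  then have "\<bar>\<phi> t - \<phi> 1 * t\<bar> > 0" by simp
  then obtain N :: nat where N: "\<phi> 1 < of_nat N * \<bar>\<phi> t - \<phi> 1 * t\<bar>"
    using reals_Archimedean3 by blast
  then have N0: "N > 0" using pos[of 1] by (cases N) auto
  define k where "k = nat \<lfloor>of_nat N * t\<rfloor>"
  have Nt: "of_nat N * t > 0" using N0 t by simp
  have k: "of_nat k \<le> of_nat N * t" "of_nat N * t < of_nat (Suc k)"
    using Nt unfolding k_def by linarith+
  \<comment> \<open>Both estimates go through \<open>Suc k\<close>, since \<open>k\<close> may be 0,
    where additivity says nothing.\<close>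
  have Sk: "\<phi> (of_nat (Suc k)) = of_nat (Suc k) * \<phi> 1"
    using of_nat_mult[of 1 "Suc k"] by simp
  have "of_nat N * \<phi> t \<le> of_nat (Suc k) * \<phi> 1"
    using increasing[of "of_nat N * t" "of_nat (Suc k)"] k Nt Sk of_nat_mult[OF t N0] by simp
  also have "\<dots> \<le> (of_nat N * t + 1) * \<phi> 1"
    using k pos[of 1] by (intro mult_right_mono) auto
  finally have upper: "of_nat N * \<phi> t \<le> of_nat N * (\<phi> 1 * t) + \<phi> 1"
    by (simp add: algebra_simps)
  have "of_nat N * t * \<phi> 1 \<le> of_nat (Suc k) * \<phi> 1"
    using k pos[of 1] by (intro mult_right_mono) auto
  also have "\<dots> \<le> \<phi> (of_nat N * t + 1)"
    using increasing[of "of_nat (Suc k)" "of_nat N * t + 1"] k Sk by simp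
  also have "\<dots> = of_nat N * \<phi> t + \<phi> 1"
    using additive[OF Nt, of 1] of_nat_mult[OF t N0] by simp
  finally have lower: "of_nat N * (\<phi> 1 * t) \<le> of_nat N * \<phi> t + \<phi> 1"
    by (simp add: algebra_simps)
  have "of_nat N * \<bar>\<phi> t - \<phi> 1 * t\<bar> = \<bar>of_nat N * \<phi> t - of_nat N * (\<phi> 1 * t)\<bar>"
    by (simp add: abs_mult flip: right_diff_distrib)
  then show False using N upper lower by linarith
qed

text \<open>The 2 x 2 matrix with diagonal \<open>s\<close>, \<open>s\<close> and off-diagonal entry
  \<open>z\<close> has a determinant changing sign at \<open>s = cmod z\<close>. Letting
  \<open>s\<close> tend to \<open>cmod z\<close> from either side confines
  \<open>cmod (g z)\<close>, as \<open>\<phi> s = \<phi> 1 * s\<close>.\<close>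

lemma norm_preserving:
  assumes "z \<in> \<Omega>"
  shows "cmod (g z) = \<phi> 1 * cmod z"
proof (cases "z = 0")
  case False
  have c: "\<phi> 1 > 0" by (simp add: pos)
  have "cmod (g z) / \<phi> 1 \<le> cmod z"
  proof (rule dense_ge)
    fix s assume s: "cmod z < s"
    then have s0: "s > 0" using norm_ge_zero[of z] by linarith
    have "(cmod z)\<^sup>2 < s * s"
      using s unfolding power2_eq_square[symmetric] by (intro power_strict_mono) auto
    then have "(cmod (g z))\<^sup>2 \<le> (\<phi> s)\<^sup>2"
      using two_by_two(1)[OF s0 s0 assms] unfolding power2_eq_square by blast
    then have "cmod (g z) \<le> \<phi> s" by (rule power2_le_imp_le[OF _ less_imp_le[OF pos[OF s0]]])
    then show "cmod (g z) / \<phi> 1 \<le> s" using c unfolding linear[OF s0] by (simp add: pos_divide_le_eq mult.commute)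
  qed
  moreover have "cmod z \<le> cmod (g z) / \<phi> 1"
  proof (rule dense_le_bounded[of 0])
    fix s assume s: "0 < s" "s < cmod z"
    have "s * s < (cmod z)\<^sup>2"
      using s unfolding power2_eq_square[symmetric] by (intro power_strict_mono) auto
    then have "(\<phi> s)\<^sup>2 \<le> (cmod (g z))\<^sup>2"
      using two_by_two(2)[OF s(1) s(1) assms] unfolding power2_eq_square by blast
    then have "\<phi> s \<le> cmod (g z)" by (rule power2_le_imp_le) simp
    then show "s \<le> cmod (g z) / \<phi> 1" using c unfolding linear[OF s(1)] by (simp add: pos_le_divide_eq mult.commute)
  qed (use False in simp)
  ultimately have "cmod (g z) / \<phi> 1 = cmod z" by (rule antisym)
  then show ?thesis using c by (simp add: divide_eq_eq mult.commute)
qed (simp add: g_0)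

text \<open>Diagonal, corner entry and moduli are all scaled by \<open>\<phi> 1\<close>. So, up to
  the factor \<open>(\<phi> 1) ^ 3\<close>, both determinants are values of one affine function, at
  \<open>\<alpha>\<close> and at \<open>\<beta>\<close>. Were these different, placing its zero
  between them would give determinants of opposite signs.\<close>

lemma Re_mult_preserving:
  assumes z: "z \<in> \<Omega>" and w: "w \<in> \<Omega>"
  shows "Re (g z * g w) = (\<phi> 1)\<^sup>2 * Re (z * w)"
proof (rule ccontr)
  assume neq: "Re (g z * g w) \<noteq> (\<phi> 1)\<^sup>2 * Re (z * w)"
  define c where "c = \<phi> 1"
  have c: "c > 0" by (simp add: pos c_def)
  \<comment> \<open>\<open>s\<close> and \<open>x\<close> are chosen such that the determinant of the matrix with diagonal \<open>s\<close> and
    off-diagonal entries \<open>z\<close>, \<open>x\<close>, \<open>w\<close> is \<open>x (\<alpha> - \<beta>)\<close>, while that of its image is a positive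
    multiple of \<open>x (\<beta> - \<alpha>)\<close>.\<close>
  define \<alpha> \<beta> M s \<mu> x where "\<alpha> = Re (z * w)" and "\<beta> = Re (g z * g w) / c\<^sup>2"
    and "M = (cmod z)\<^sup>2 + (cmod w)\<^sup>2" and "s = sqrt (M + 1)"
    and "\<mu> = (\<alpha> + \<beta>) / 2" and "x = (\<mu> + sqrt (\<mu>\<^sup>2 + s\<^sup>2)) / s"
  have M: "M \<ge> 0" by (simp add: M_def)
  then have s: "s > 0" and s2: "s\<^sup>2 = M + 1" by (simp_all add: s_def)
  have "\<bar>\<mu>\<bar> < sqrt (\<mu>\<^sup>2 + s\<^sup>2)"
    using s by (intro real_less_rsqrt) simp
  then have x: "x > 0" using s by (simp add: x_def)
  \<comment> \<open>\<open>x\<close> is the positive root of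
    \<open>s * x\<^sup>2 - 2 * x * \<mu> - s = 0\<close>. Given \<open>s\<^sup>2 = M + 1\<close>,
    this equation says that the affine function vanishes at the midpoint
    \<open>\<mu>\<close>.\<close>
  have "(s * x - \<mu>)\<^sup>2 = \<mu>\<^sup>2 + s\<^sup>2"
    using s by (simp add: x_def)
  then have "s * (s * x\<^sup>2 - 2 * x * \<mu> - s) = 0"
    by (simp add: power2_eq_square algebra_simps)
  then have root: "s * x\<^sup>2 - 2 * x * \<mu> = s" using s by simp
  have det: "s ^ 3 + 2 * x * \<gamma> - s * ((cmod z)\<^sup>2 + x\<^sup>2 + (cmod w)\<^sup>2) = 2 * x * (\<gamma> - \<mu>)" for \<gamma>
  proof -
    have "s ^ 3 = s * s\<^sup>2" by (simp add: power2_eq_square power3_eq_cube)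
    then have "s ^ 3 = s * M + s" by (simp add: s2 distrib_left)
    moreover have "s * ((cmod z)\<^sup>2 + x\<^sup>2 + (cmod w)\<^sup>2) = s * M + s * x\<^sup>2"
      by (simp add: M_def algebra_simps)
    ultimately show ?thesis using root by (simp add: right_diff_distrib)
  qed
  have "\<alpha> - \<mu> = (\<alpha> - \<beta>) / 2" "\<beta> - \<mu> = (\<beta> - \<alpha>) / 2"
    by (simp_all add: \<mu>_def diff_divide_distrib add_divide_distrib)
  then have mid: "2 * x * (\<alpha> - \<mu>) = x * (\<alpha> - \<beta>)" "2 * x * (\<beta> - \<mu>) = x * (\<beta> - \<alpha>)"
    by simp_all
  have det_A: "det3 s s s z (of_real x) w = x * (\<alpha> - \<beta>)"
    unfolding det3_constant_diagonal \<alpha>_def[symmetric] det mid ..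
  have \<phi>: "\<phi> s = c * s" "\<phi> x = c * x" by (simp_all only: c_def linear[OF s] linear[OF x])
  have norm: "cmod (g z) = c * cmod z" "cmod (g w) = c * cmod w"
    using norm_preserving z w by (simp_all add: c_def)
  have \<beta>: "Re (g z * g w) = c\<^sup>2 * \<beta>" using c by (simp add: \<beta>_def)
  have "det3 (c * s) (c * s) (c * s) (g z) (of_real (c * x)) (g w) = c ^ 3 *
      (s ^ 3 + 2 * x * \<beta> - s * ((cmod z)\<^sup>2 + x\<^sup>2 + (cmod w)\<^sup>2))"
    unfolding det3_constant_diagonal \<beta> norm
    by (simp add: algebra_simps power2_eq_square power3_eq_cube)
  then have det_gA: "det3 (\<phi> s) (\<phi> s) (\<phi> s) (g z) (g (of_real x)) (g w) = c ^ 3 * (x * (\<beta> - \<alpha>))"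
    unfolding det mid g_of_real[OF x] \<phi> .
  \<comment> \<open>The summand 1 in \<open>s\<^sup>2 = M + 1\<close> keeps this strict even for
    \<open>w = 0\<close>.\<close>
  have "(cmod z)\<^sup>2 < s\<^sup>2"
    unfolding s2 M_def using zero_le_power2[of "cmod w"] by linarith
  then have minor: "(cmod z)\<^sup>2 < s * s" by (simp only: power2_eq_square)
  have "(cmod (g z))\<^sup>2 = c\<^sup>2 * (cmod z)\<^sup>2" "\<phi> s * \<phi> s = c\<^sup>2 * (s * s)"
    unfolding norm \<phi> by (simp_all add: power2_eq_square)
  then have minor_g: "(cmod (g z))\<^sup>2 < \<phi> s * \<phi> s"
    using mult_strict_left_mono[OF minor, of "c\<^sup>2"] c by simp
  have c3: "c ^ 3 > 0" using c by simp
  have "\<alpha> \<noteq> \<beta>" using neq \<beta> by (auto simp: \<alpha>_def c_def)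
  then consider "\<alpha> > \<beta>" | "\<alpha> < \<beta>" by linarith
  then show False
  proof cases
    case 1
    then have "c ^ 3 * (x * (\<beta> - \<alpha>)) < 0" "x * (\<alpha> - \<beta>) > 0"
      using c3 x by (simp_all add: mult_pos_neg)
    then show False
      using det3_pos[OF s s s z of_real_mem w minor minor_g, of x] unfolding det_A det_gA by simp
  next
    case 2
    then have "c ^ 3 * (x * (\<beta> - \<alpha>)) > 0" "x * (\<alpha> - \<beta>) < 0"
      using c3 x by (simp_all add: mult_pos_neg)
    then show False
      using det3_neg[OF s s s z of_real_mem w minor minor_g, of x] unfolding det_A det_gA by simp
  qed
qed

end

section \<open>Reduction to order three\<close>

lemma hform_restrict:
  assumes "m \<le> n" and v: "\<And>i. m \<le> i \<Longrightarrow> i < n \<Longrightarrow> v i = 0"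
  shows "hform n M v = hform m M v"
proof -
  have inner: "(\<Sum>j<n. M i j * v j * conjugate (v i)) = (\<Sum>j<m. M i j * v j * conjugate (v i))" for i
    using assms by (intro sum.mono_neutral_right) auto
  show ?thesis
    unfolding hform_def inner using assms by (intro sum.mono_neutral_right) auto
qed

lemma hform_unit:
  assumes "i < n"
  shows "hform n M (\<lambda>j. if j = i then 1 else 0) = (M i i :: complex)"
proof -
  have "(\<Sum>j<n. M i j * (if j = i then 1 else 0)) = (\<Sum>j<n. if j = i then M i j else 0)"
    by (rule sum.cong) auto
  then have "(\<Sum>j<n. M i j * (if j = i then 1 else 0)) = M i i"
    using assms by simp
  then have "hform n M (\<lambda>j. if j = i then 1 else 0) = (\<Sum>k<n. if k = i then M i i else 0)"
    unfolding hform_def by (intro sum.cong) auto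
  then show ?thesis using assms by simp
qed

lemma psd_kernel_diag:
  assumes "psd_kernel n M" "i < n"
  shows "0 \<le> Re (M i i)" "M i i = of_real (Re (M i i))"
proof -
  show "0 \<le> Re (M i i)"
    using assms hform_unit[OF assms(2), of M] unfolding psd_kernel_def by metis
  have "Im (M i i) = 0"
    using assms hform_unit[OF assms(2), of M] Im_hform_hermitian[of n M] unfolding psd_kernel_def
    by metis
  then show "M i i = of_real (Re (M i i))" by (simp add: complex_eq_iff)
qed

lemma pd_kernel_imp_psd_kernel:
  assumes "pd_kernel n M"
  shows "psd_kernel n M"
  unfolding psd_kernel_def
proof (intro conjI allI)
  show "hermitian_kernel n M" using assms by (simp add: pd_kernel_def)
  fix v show "0 \<le> Re (hform n M v)"
  proof (cases "\<exists>i<n. v i \<noteq> 0")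
    case True
    then show ?thesis using assms unfolding pd_kernel_def by (metis less_imp_le)
  next
    case False
    then show ?thesis by (simp add: hform_def)
  qed
qed

lemma pd_kernelD:
  assumes "pd_kernel n M" "i < n" "v i \<noteq> 0"
  shows "0 < Re (hform n M v)"
proof -
  have "(\<exists>i<n. v i \<noteq> 0) \<longrightarrow> 0 < Re (hform n M v)"
    by (rule spec[OF conjunct2[OF assms(1)[unfolded pd_kernel_def]]])
  then show ?thesis using assms(2,3) by blast
qed

lemma pd_kernel_diag:
  assumes "pd_kernel n M" "i < n"
  shows "0 < Re (M i i)"
proof -
  have "0 < Re (hform n M (\<lambda>j. if j = i then 1 else 0))"
    by (rule pd_kernelD[OF assms]) simp
  then show ?thesis unfolding hform_unit[OF assms(2)] .
qed

section \<open>Equicorrelation matrices and monotonicity on the positive reals\<close>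

definition equicorrelation :: "real \<Rightarrow> real \<Rightarrow> nat \<Rightarrow> nat \<Rightarrow> complex" where
  "equicorrelation a b i j = of_real (if i = j then a else b)"

lemma hermitian_equicorrelation: "hermitian_kernel n (equicorrelation a b)"
  by (simp add: hermitian_kernel_def equicorrelation_def)

text \<open>The matrix is \<open>(a - b) I + b J\<close>, and the all-ones matrix \<open>J\<close>
  has as its form the squared modulus of the coordinate sum.\<close>

lemma hform_equicorrelation:
  "hform n (equicorrelation a b) v =
     of_real ((a - b) * (\<Sum>i<n. (cmod (v i))\<^sup>2) + b * (cmod (\<Sum>i<n. v i))\<^sup>2)"
proof -
  have "hform n (equicorrelation a b) v = (\<Sum>i<n. \<Sum>j<n.
      (if i = j then of_real (a - b) * (v i * cnj (v i)) else 0) + of_real b * (v j * cnj (v i)))"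
    unfolding hform_def
    by (intro sum.cong refl) (simp add: equicorrelation_def left_diff_distrib mult.assoc)
  also have "\<dots> = (\<Sum>i<n. of_real (a - b) * (v i * cnj (v i))) +
      of_real b * (\<Sum>i<n. \<Sum>j<n. v j * cnj (v i))"
    unfolding sum.distrib sum_distrib_left by simp
  also have "(\<Sum>i<n. \<Sum>j<n. v j * cnj (v i)) = (\<Sum>i<n. v i) * cnj (\<Sum>i<n. v i)"
    unfolding cnj_sum sum_product by (rule sum.swap)
  finally show ?thesis
    unfolding of_real_add of_real_mult of_real_sum complex_norm_square sum_distrib_left .
qed

lemma psd_equicorrelationI:
  assumes "0 \<le> b" "b \<le> a"
  shows "psd_kernel n (equicorrelation a b)"
  using assms
  by (auto simp: psd_kernel_def hermitian_equicorrelation hform_equicorrelation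
      intro!: add_nonneg_nonneg mult_nonneg_nonneg sum_nonneg)

lemma pd_equicorrelationI:
  assumes "0 \<le> b" "b < a"
  shows "pd_kernel n (equicorrelation a b)"
  unfolding pd_kernel_def
proof (intro conjI allI impI)
  fix v :: "nat \<Rightarrow> complex" assume "\<exists>i<n. v i \<noteq> 0"
  then obtain i where "i < n" "v i \<noteq> 0" by blast
  then have "0 < (\<Sum>i<n. (cmod (v i))\<^sup>2)"
    by (intro sum_pos2[of "{..<n}" i]) simp_all
  then have "0 < (a - b) * (\<Sum>i<n. (cmod (v i))\<^sup>2)"
    using assms by (intro mult_pos_pos) simp_all
  moreover have "0 \<le> b * (cmod (\<Sum>i<n. v i))\<^sup>2"
    using assms by simp
  ultimately show "0 < Re (hform n (equicorrelation a b) v)"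
    unfolding hform_equicorrelation by simp
qed (rule hermitian_equicorrelation)

text \<open>The difference of the first two unit vectors has coordinate sum zero, so the form at it
  sees only \<open>a - b\<close>.\<close>

lemma
  assumes "n \<ge> 2"
  shows psd_equicorrelationD: "psd_kernel n (equicorrelation a b) \<Longrightarrow> b \<le> a"
    and pd_equicorrelationD: "pd_kernel n (equicorrelation a b) \<Longrightarrow> b < a"
proof -
  define v :: "nat \<Rightarrow> complex" where "v i = (if i = 0 then 1 else if i = 1 then - 1 else 0)" for i
  have "hform n (equicorrelation a b) v = hform 2 (equicorrelation a b) v"
    using assms by (intro hform_restrict) (auto simp: v_def)
  also have "\<dots> = of_real (2 * (a - b))"
    by (simp add: hform_equicorrelation v_def numeral_2_eq_2 algebra_simps)
  finally have v: "Re (hform n (equicorrelation a b) v) = 2 * (a - b)" by simp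
  show "b \<le> a" if "psd_kernel n (equicorrelation a b)"
  proof -
    have "0 \<le> Re (hform n (equicorrelation a b) v)" using that by (simp add: psd_kernel_def)
    then show ?thesis using v by simp
  qed
  show "b < a" if "pd_kernel n (equicorrelation a b)"
  proof -
    have "0 < Re (hform n (equicorrelation a b) v)"
      using assms by (intro pd_kernelD[OF that, of 0]) (simp_all add: v_def)
    then show ?thesis using v by simp
  qed
qed

lemma sign_preserverD:
  assumes "sign_preserver P n \<Omega> g" "\<And>i j. i < n \<Longrightarrow> j < n \<Longrightarrow> M i j \<in> \<Omega>" "hermitian_kernel n M"
  shows "P n M \<longleftrightarrow> P n (\<lambda>i j. g (M i j))"
  using assms unfolding sign_preserver_def by blast

text \<open>Only positive arguments occur: diagonal entries of definite matrices are positive, so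
  the definite case gives no immediate hold on \<open>g 0\<close>.\<close>

definition real_positive_increasing :: "(complex \<Rightarrow> complex) \<Rightarrow> bool" where
  "real_positive_increasing g \<longleftrightarrow>
     (\<forall>t>0. g (of_real t) = of_real (Re (g (of_real t))) \<and> 0 < Re (g (of_real t))) \<and>
     (\<forall>s t. 0 < s \<longrightarrow> s < t \<longrightarrow> Re (g (of_real s)) < Re (g (of_real t)))"

text \<open>Constant matrices yield nonnegativity, at 0 too. Strict growth uses the converse
  direction: if \<open>\<phi> t \<le> \<phi> s\<close> with \<open>s < t\<close>, the matrix with
  diagonal \<open>s\<close> and off-diagonal \<open>t\<close> has a semidefinite image without being
  semidefinite.\<close>

lemma psd_sign_preserver_increasing:
  assumes g: "sign_preserver psd_kernel n \<Omega> g" and "\<real> \<subseteq> \<Omega>" "n \<ge> 2"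
  shows "real_positive_increasing g"
proof -
  define \<phi> where "\<phi> t = Re (g (of_real t))" for t
  have E: "psd_kernel n (equicorrelation a b) \<longleftrightarrow> psd_kernel n (\<lambda>i j. g (equicorrelation a b i j))"
    for a b
    using assms(2) by (intro sign_preserverD[OF g]) (auto simp: equicorrelation_def hermitian_equicorrelation)
  have nonneg: "g (of_real t) = of_real (\<phi> t) \<and> 0 \<le> \<phi> t" if "t \<ge> 0" for t
  proof -
    have "psd_kernel n (\<lambda>i j. g (equicorrelation t t i j))"
      using E[of t t] psd_equicorrelationI[of t t] that by simp
    from psd_kernel_diag[OF this, of 0] show ?thesis
      using assms(3) by (simp add: \<phi>_def equicorrelation_def)
  qed
  have incr: "\<phi> s < \<phi> t" if "0 \<le> s" "s < t" for s t
  proof (rule ccontr)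
    assume "\<not> \<phi> s < \<phi> t"
    then have "psd_kernel n (equicorrelation (\<phi> s) (\<phi> t))"
      using nonneg[of t] that by (intro psd_equicorrelationI) auto
    also have "equicorrelation (\<phi> s) (\<phi> t) = (\<lambda>i j. g (equicorrelation s t i j))"
      using nonneg[of s] nonneg[of t] that by (auto simp: equicorrelation_def fun_eq_iff)
    finally have "psd_kernel n (equicorrelation s t)" using E by blast
    then show False using psd_equicorrelationD[OF assms(3)] that by fastforce
  qed
  have "0 < \<phi> t" if "t > 0" for t
    using incr[of 0 t] nonneg[of 0] that by simp
  then show ?thesis
    unfolding real_positive_increasing_def \<phi>_def[symmetric] using nonneg incr by force
qed

text \<open>Here the forward direction suffices: the image of \<open>t I\<close> has a positive
  diagonal, and diagonal \<open>t\<close> with off-diagonal \<open>s < t\<close> is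
  definite.\<close>

lemma pd_sign_preserver_increasing:
  assumes g: "sign_preserver pd_kernel n \<Omega> g" and "\<real> \<subseteq> \<Omega>" "n \<ge> 2"
  shows "real_positive_increasing g"
proof -
  define \<phi> where "\<phi> t = Re (g (of_real t))" for t
  have E: "pd_kernel n (equicorrelation a b) \<longleftrightarrow> pd_kernel n (\<lambda>i j. g (equicorrelation a b i j))"
    for a b
    using assms(2) by (intro sign_preserverD[OF g]) (auto simp: equicorrelation_def hermitian_equicorrelation)
  have pos: "g (of_real t) = of_real (\<phi> t) \<and> 0 < \<phi> t" if "t > 0" for t
  proof -
    have "pd_kernel n (\<lambda>i j. g (equicorrelation t 0 i j))"
      using E[of t 0] pd_equicorrelationI[of 0 t] that by simp
    from pd_kernel_diag[OF this, of 0] psd_kernel_diag[OF pd_kernel_imp_psd_kernel[OF this], of 0]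
    show ?thesis
      using assms(3) by (simp add: \<phi>_def equicorrelation_def)
  qed
  have incr: "\<phi> s < \<phi> t" if "0 < s" "s < t" for s t
  proof -
    have "pd_kernel n (equicorrelation t s)"
      using that by (intro pd_equicorrelationI) auto
    then have "pd_kernel n (\<lambda>i j. g (equicorrelation t s i j))" using E by blast
    also have "(\<lambda>i j. g (equicorrelation t s i j)) = equicorrelation (\<phi> t) (\<phi> s)"
      using pos[of s] pos[of t] that by (auto simp: equicorrelation_def fun_eq_iff)
    finally show ?thesis by (rule pd_equicorrelationD[OF assms(3)])
  qed
  show ?thesis
    unfolding real_positive_increasing_def \<phi>_def[symmetric] using pos incr by blast
qed

text \<open>Pulling \<open>M\<close> back along \<open>\<pi>\<close> is the congruence
  \<open>S\<^sup>T M S\<close> with the 0-1 matrix \<open>S\<close> of \<open>\<pi>\<close>, and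
  \<open>S v\<close> sums \<open>v\<close> over the fibres.\<close>

lemma hform_pushforward:
  fixes M :: "nat \<Rightarrow> nat \<Rightarrow> complex" and v :: "nat \<Rightarrow> complex"
  assumes \<pi>: "\<And>i. i < n \<Longrightarrow> \<pi> i < m"
  shows "hform n (\<lambda>i j. M (\<pi> i) (\<pi> j)) v = hform m M (\<lambda>k. \<Sum>i\<in>{i\<in>{..<n}. \<pi> i = k}. v i)"
proof -
  define V where "V k = (\<Sum>i\<in>{i\<in>{..<n}. \<pi> i = k}. v i)" for k
  have group: "(\<Sum>i<n. h i) = (\<Sum>k<m. \<Sum>i\<in>{i\<in>{..<n}. \<pi> i = k}. h i)" for h :: "nat \<Rightarrow> complex"
    using \<pi> by (intro sum.group[symmetric]) auto
  have inner: "(\<Sum>j<n. M k (\<pi> j) * v j * c) = (\<Sum>l<m. M k l * V l * c)" for k c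
  proof -
    have "(\<Sum>j<n. M k (\<pi> j) * v j * c) =
        (\<Sum>l<m. \<Sum>j\<in>{i\<in>{..<n}. \<pi> i = l}. M k l * v j * c)"
      unfolding group by (intro sum.cong refl) auto
    then show ?thesis by (simp add: V_def sum_distrib_left sum_distrib_right)
  qed
  have "hform n (\<lambda>i j. M (\<pi> i) (\<pi> j)) v = (\<Sum>i<n. \<Sum>l<m. M (\<pi> i) l * V l * cnj (v i))"
    unfolding hform_def conjugate_complex_def inner ..
  also have "\<dots> = (\<Sum>k<m. \<Sum>i\<in>{i\<in>{..<n}. \<pi> i = k}. \<Sum>l<m. M k l * V l * cnj (v i))"
    unfolding group by (intro sum.cong refl) auto
  also have "\<dots> = (\<Sum>k<m. \<Sum>l<m. M k l * V l * cnj (V k))"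
    by (rule sum.cong[OF refl], subst sum.swap) (simp add: V_def sum_distrib_left)
  finally show ?thesis by (simp add: hform_def V_def)
qed

text \<open>The last index of a \<open>3 \<times> 3\<close> matrix is repeated. Padding with zeros would not do, since
  \<open>g 0 = 0\<close> is not known in advance; the positive \<open>\<delta>\<close> keeps definite matrices definite.\<close>

definition spread :: "(nat \<Rightarrow> nat \<Rightarrow> complex) \<Rightarrow> real \<Rightarrow> nat \<Rightarrow> nat \<Rightarrow> complex" where
  "spread M \<delta> i j = M (min i 2) (min j 2) + (if i = j \<and> 3 \<le> i then of_real \<delta> else 0)"

lemma spread_low: "i < 3 \<Longrightarrow> j < 3 \<Longrightarrow> spread M \<delta> i j = M i j"
  by (simp add: spread_def min_def)

lemma hform_spread:
  assumes "n \<ge> 3"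
  shows "hform n (spread M \<delta>) v =
    hform 3 M (\<lambda>k. \<Sum>i\<in>{i\<in>{..<n}. min i 2 = k}. v i) + of_real (\<delta> * (\<Sum>i=3..<n. (cmod (v i))\<^sup>2))"
proof -
  have "hform n (spread M \<delta>) v = hform n (\<lambda>i j. M (min i 2) (min j 2)) v +
      (\<Sum>i<n. \<Sum>j<n. if i = j then (if 3 \<le> i then of_real \<delta> * (v i * cnj (v i)) else 0) else 0)"
    unfolding hform_def sum.distrib[symmetric]
    by (intro sum.cong refl) (auto simp: spread_def algebra_simps)
  also have "(\<Sum>i<n. \<Sum>j<n. if i = j then (if 3 \<le> i then of_real \<delta> * (v i * cnj (v i)) else 0) else 0)
      = (\<Sum>i<n. if 3 \<le> i then of_real \<delta> * (v i * cnj (v i)) else 0)"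
    by simp
  also have "\<dots> = (\<Sum>i=3..<n. of_real \<delta> * (v i * cnj (v i)))"
    by (intro sum.mono_neutral_cong_right) auto
  also have "\<dots> = of_real (\<delta> * (\<Sum>i=3..<n. (cmod (v i))\<^sup>2))"
    by (simp add: complex_norm_square sum_distrib_left del: of_real_power)
  also have "hform n (\<lambda>i j. M (min i 2) (min j 2)) v =
      hform 3 M (\<lambda>k. \<Sum>i\<in>{i\<in>{..<n}. min i 2 = k}. v i)"
    by (rule hform_pushforward) auto
  finally show ?thesis .
qed

lemma hform_spread_low:
  assumes "n \<ge> 3" and "\<And>i. 3 \<le> i \<Longrightarrow> i < n \<Longrightarrow> v i = 0"
  shows "hform n (spread M \<delta>) v = hform 3 M v"
proof -
  have "hform n (spread M \<delta>) v = hform 3 (spread M \<delta>) v"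
    using assms by (intro hform_restrict)
  also have "\<dots> = hform 3 M v"
    by (rule hform_cong) (auto simp: spread_low)
  finally show ?thesis .
qed

lemma hermitian_spread:
  assumes "n \<ge> 3"
  shows "hermitian_kernel n (spread M \<delta>) \<longleftrightarrow> hermitian_kernel 3 M"
proof
  assume H: "hermitian_kernel n (spread M \<delta>)"
  show "hermitian_kernel 3 M"
    unfolding hermitian_kernel_def
  proof (intro allI impI)
    fix i j :: nat assume ij: "i < 3" "j < 3"
    have "spread M \<delta> j i = cnj (spread M \<delta> i j)"
      by (rule hermitian_kernelD[OF H]) (use ij assms in simp_all)
    then show "M j i = cnj (M i j)" unfolding spread_low[OF ij] spread_low[OF ij(2,1)] .
  qed
next
  assume H: "hermitian_kernel 3 M"
  show "hermitian_kernel n (spread M \<delta>)"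
    unfolding hermitian_kernel_def
  proof (intro allI impI)
    fix i j
    have "M (min j 2) (min i 2) = cnj (M (min i 2) (min j 2))"
      by (rule hermitian_kernelD[OF H]) simp_all
    then show "spread M \<delta> j i = cnj (spread M \<delta> i j)"
      unfolding spread_def complex_cnj_add by (intro arg_cong2[of _ _ _ _ "(+)"]) auto
  qed
qed

text \<open>Test vectors for \<open>M\<close> are extended by zeros; conversely
  \<open>hform_spread\<close> exhibits a value of the form of \<open>M\<close> plus a nonnegative
  term.\<close>

lemma psd_spread:
  assumes n: "n \<ge> 3" and \<delta>: "\<delta> > 0"
  shows "psd_kernel n (spread M \<delta>) \<longleftrightarrow> psd_kernel 3 M"
proof -
  have "(\<forall>v. 0 \<le> Re (hform n (spread M \<delta>) v)) \<longleftrightarrow> (\<forall>v. 0 \<le> Re (hform 3 M v))" (is "?L \<longleftrightarrow> ?R")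
  proof
    assume L: ?L
    show ?R
    proof
      fix v :: "nat \<Rightarrow> complex"
      define w where "w i = (if i < 3 then v i else 0)" for i
      have "hform 3 M v = hform 3 M w" by (rule hform_cong) (auto simp: w_def)
      also have "\<dots> = hform n (spread M \<delta>) w"
        by (rule hform_spread_low[OF n, symmetric]) (auto simp: w_def)
      finally show "0 \<le> Re (hform 3 M v)" using L by simp
    qed
  next
    assume ?R
    then show ?L
      using \<delta> by (auto simp: hform_spread[OF n] intro!: add_nonneg_nonneg mult_nonneg_nonneg sum_nonneg)
  qed
  then show ?thesis unfolding psd_kernel_def by (simp add: hermitian_spread[OF n])
qed

lemma pd_spread:
  assumes n: "n \<ge> 3" and \<delta>: "\<delta> > 0"
  shows "pd_kernel n (spread M \<delta>) \<longleftrightarrow> pd_kernel 3 M"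
proof
  assume L: "pd_kernel n (spread M \<delta>)"
  show "pd_kernel 3 M"
    unfolding pd_kernel_def
  proof (intro conjI allI impI)
    show "hermitian_kernel 3 M" using L by (simp add: pd_kernel_def hermitian_spread[OF n])
    fix v :: "nat \<Rightarrow> complex" assume "\<exists>i<3. v i \<noteq> 0"
    then obtain i where i: "i < 3" "v i \<noteq> 0" by blast
    define w where "w i = (if i < 3 then v i else 0)" for i
    have "hform 3 M v = hform 3 M w" by (rule hform_cong) (auto simp: w_def)
    also have "\<dots> = hform n (spread M \<delta>) w"
      by (rule hform_spread_low[OF n, symmetric]) (auto simp: w_def)
    finally show "0 < Re (hform 3 M v)"
      using pd_kernelD[OF L, of i w] i n by (simp add: w_def)
  qed
next
  assume R: "pd_kernel 3 M"
  then have psd: "0 \<le> Re (hform 3 M v)" for v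
    using pd_kernel_imp_psd_kernel by (auto simp: psd_kernel_def)
  show "pd_kernel n (spread M \<delta>)"
    unfolding pd_kernel_def
  proof (intro conjI allI impI)
    show "hermitian_kernel n (spread M \<delta>)" using R by (simp add: pd_kernel_def hermitian_spread[OF n])
    fix v :: "nat \<Rightarrow> complex" assume v: "\<exists>i<n. v i \<noteq> 0"
    show "0 < Re (hform n (spread M \<delta>) v)"
    \<comment> \<open>The fibre sums of \<open>v\<close> may all vanish. In that event some
      coordinate from index 3 on is nonzero, and the \<open>\<delta>\<close> term supplies
      positivity.\<close>
    proof (cases "\<exists>i\<in>{3..<n}. v i \<noteq> 0")
      case True
      then obtain i where "i \<in> {3..<n}" "v i \<noteq> 0" by blast
      then have "0 < (\<Sum>i=3..<n. (cmod (v i))\<^sup>2)"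
        by (intro sum_pos2[of "{3..<n}" i]) simp_all
      then have "0 < \<delta> * (\<Sum>i=3..<n. (cmod (v i))\<^sup>2)"
        using \<delta> by (intro mult_pos_pos) simp_all
      then show ?thesis
        unfolding hform_spread[OF n] plus_complex.sel Re_complex_of_real
        using psd by (rule add_nonneg_pos[rotated])
    next
      case False
      then have "hform n (spread M \<delta>) v = hform 3 M v"
        by (intro hform_spread_low[OF n]) auto
      moreover obtain i where "i < n" "v i \<noteq> 0" using v by blast
      ultimately show ?thesis using pd_kernelD[OF R, of i v] False by (cases "i < 3") auto
    qed
  qed
qed

text \<open>Apart from entries of \<open>M\<close>, \<open>spread M 1\<close> contains only
  \<open>c + 1\<close>. So its image is again a spread matrix, with increment
  \<open>\<phi> (c + 1) - \<phi> c\<close>, positive by strict growth.\<close>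

lemma sign_preserver_3:
  assumes P: "P = psd_kernel \<or> P = pd_kernel"
    and n: "n \<ge> 3" and g: "sign_preserver P n \<Omega> g" and "\<real> \<subseteq> \<Omega>" "real_positive_increasing g"
    and M: "\<And>i j. i < 3 \<Longrightarrow> j < 3 \<Longrightarrow> M i j \<in> \<Omega>" and H: "hermitian_kernel 3 M"
    and c: "M 2 2 = of_real c" "c > 0"
  shows "P 3 M \<longleftrightarrow> P 3 (\<lambda>i j. g (M i j))"
proof -
  define \<phi> where "\<phi> t = Re (g (of_real t))" for t
  have \<phi>: "g (of_real t) = of_real (\<phi> t)" if "t > 0" for t
    using assms(5) that unfolding real_positive_increasing_def \<phi>_def by blast
  define \<delta> where "\<delta> = \<phi> (c + 1) - \<phi> c"
  have "\<phi> c < \<phi> (c + 1)"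
    using assms(5) c(2) less_add_one unfolding real_positive_increasing_def \<phi>_def by blast
  then have \<delta>: "\<delta> > 0" by (simp add: \<delta>_def)
  have "g (of_real c + 1) = of_real (\<phi> (c + 1))"
    using \<phi>[of "c + 1"] c by simp
  then have g_Suc: "g (of_real c + 1) = g (of_real c) + of_real \<delta>"
    using \<phi>[of c] c by (simp add: \<delta>_def)
  have spread_g: "(\<lambda>i j. g (spread M 1 i j)) = spread (\<lambda>i j. g (M i j)) \<delta>"
    using g_Suc by (auto simp: fun_eq_iff spread_def min_def c)
  have spread_P: "P n (spread N d) \<longleftrightarrow> P 3 N" if "d > 0" for N d
    using P by (elim disjE) (simp_all add: psd_spread[OF n that] pd_spread[OF n that])
  have "P n (spread M 1) \<longleftrightarrow> P n (\<lambda>i j. g (spread M 1 i j))"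
  proof (rule sign_preserverD[OF g])
    show "spread M 1 i j \<in> \<Omega>" for i j
    proof (cases "i = j \<and> 3 \<le> i")
      case True
      then have "spread M 1 i j = of_real (c + 1)" by (simp add: spread_def min_def c)
      then show ?thesis using assms(4) by (metis Reals_of_real subsetD)
    qed (use M in \<open>auto simp: spread_def\<close>)
  qed (simp add: hermitian_spread[OF n] H)
  then show ?thesis
    unfolding spread_g spread_P[OF \<delta>] using spread_P[of 1 M] by simp
qed

section \<open>Sylvester's criterion in order three\<close>

definition kernel3 :: "real \<Rightarrow> real \<Rightarrow> real \<Rightarrow> complex \<Rightarrow> complex \<Rightarrow> complex \<Rightarrow> nat \<Rightarrow> nat \<Rightarrow> complex" where
  "kernel3 a b c x y z i j =
     [[of_real a, x, y], [cnj x, of_real b, z], [cnj y, cnj z, of_real c]] ! i ! j"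

lemma less_3_cases: "i < 3 \<longleftrightarrow> i = 0 \<or> i = 1 \<or> i = (2::nat)"
  by auto

lemma hermitian_kernel3: "hermitian_kernel 3 (kernel3 a b c x y z)"
  by (auto simp: hermitian_kernel_def kernel3_def less_3_cases)

lemma Re_hform_kernel3:
  "Re (hform 3 (kernel3 a b c x y z) v) =
     a * (cmod (v 0))\<^sup>2 + b * (cmod (v 1))\<^sup>2 + c * (cmod (v 2))\<^sup>2 +
     2 * Re (x * v 1 * cnj (v 0)) + 2 * Re (y * v 2 * cnj (v 0)) + 2 * Re (z * v 2 * cnj (v 1))"
proof -
  have lt3: "{..<3} = {0, 1, 2::nat}" by auto
  show ?thesis
    unfolding hform_def lt3 cmod_power2
    by (simp add: kernel3_def algebra_simps power2_eq_square)
qed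

text \<open>Squares are completed twice: \<open>a * Q\<close> is a square plus a binary form
  \<open>R\<close> in \<open>v 1\<close> and \<open>v 2\<close>, and \<open>B * R\<close> is a
  square plus \<open>a\<close> times the determinant times
  \<open>(cmod (v 2))\<^sup>2\<close>.\<close>

lemma pd_kernel3:
  assumes a: "a > 0" and B: "(cmod x)\<^sup>2 < a * b" and det: "det3 a b c x y z > 0"
  shows "pd_kernel 3 (kernel3 a b c x y z)"
  unfolding pd_kernel_def
proof (intro conjI allI impI)
  fix v :: "nat \<Rightarrow> complex" assume "\<exists>i<3. v i \<noteq> 0"
  then have v: "v 0 \<noteq> 0 \<or> v 1 \<noteq> 0 \<or> v 2 \<noteq> 0" by (auto simp: less_3_cases)
  define Q where "Q = Re (hform 3 (kernel3 a b c x y z) v)"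
  define B where "B = a * b - (cmod x)\<^sup>2"
  define w where "w = of_real a * z - cnj x * y"
  define R where "R = B * (cmod (v 1))\<^sup>2 + 2 * Re (w * v 2 * cnj (v 1)) + (a * c - (cmod y)\<^sup>2) * (cmod (v 2))\<^sup>2"
  have Bpos: "B > 0" using B by (simp add: B_def)
  have Q: "a * Q = (cmod (of_real a * v 0 + (x * v 1 + y * v 2)))\<^sup>2 + R"
    unfolding Q_def R_def B_def w_def Re_hform_kernel3 cmod_power2
    by (simp add: algebra_simps power2_eq_square)
  \<comment> \<open>Sylvester's determinant identity: \<open>B\<close>, \<open>w\<close> and
    \<open>a * c - (cmod y)\<^sup>2\<close> are the 2 x 2 minors bordering the entry
    \<open>a\<close>.\<close>
  have D: "B * (a * c - (cmod y)\<^sup>2) - (cmod w)\<^sup>2 = a * det3 a b c x y z"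
    unfolding B_def w_def det3_def cmod_power2
    by (simp add: algebra_simps power2_eq_square)
  have "B * R = (cmod (of_real B * v 1 + w * v 2))\<^sup>2 +
      (B * (a * c - (cmod y)\<^sup>2) - (cmod w)\<^sup>2) * (cmod (v 2))\<^sup>2"
    unfolding R_def cmod_power2 by (simp add: algebra_simps power2_eq_square)
  then have R: "B * R = (cmod (of_real B * v 1 + w * v 2))\<^sup>2 + a * det3 a b c x y z * (cmod (v 2))\<^sup>2"
    unfolding D .
  have D2: "a * det3 a b c x y z > 0" using a det by simp
  have BR: "B * R > 0" if "v 1 \<noteq> 0 \<or> v 2 \<noteq> 0"
  proof (cases "v 2 = 0")
    case True
    then show ?thesis using R that Bpos by simp
  next
    case False
    then have "a * det3 a b c x y z * (cmod (v 2))\<^sup>2 > 0" using D2 by simp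
    then show ?thesis unfolding R by (intro add_nonneg_pos) simp_all
  qed
  have "a * Q > 0"
  proof (cases "v 1 \<noteq> 0 \<or> v 2 \<noteq> 0")
    case True
    then have "R > 0" using BR Bpos by (simp add: zero_less_mult_iff)
    then show ?thesis unfolding Q by (intro add_nonneg_pos) simp_all
  next
    case False
    then show ?thesis using v a unfolding Q R_def by simp
  qed
  then show "0 < Re (hform 3 (kernel3 a b c x y z) v)"
    using a by (simp add: Q_def zero_less_mult_iff)
qed (rule hermitian_kernel3)

text \<open>The matrix sends the last column of its adjugate to the determinant times the last unit
  vector. The form there is thus the positive leading minor times the determinant.\<close>

lemma psd_kernel3_det:
  assumes "psd_kernel 3 (kernel3 a b c x y z)" and B: "(cmod x)\<^sup>2 < a * b"
  shows "det3 a b c x y z \<ge> 0"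
proof -
  \<comment> \<open>the last column of the adjugate\<close>
  define v where "v i = [x * z - of_real b * y, cnj x * y - of_real a * z, of_real (a * b - ((Re x)\<^sup>2 + (Im x)\<^sup>2))] ! i" for i
  have "Re (hform 3 (kernel3 a b c x y z) v) = (a * b - (cmod x)\<^sup>2) * det3 a b c x y z"
    unfolding Re_hform_kernel3 det3_def cmod_power2
    by (simp add: v_def cmod_power2 algebra_simps power2_eq_square)
  moreover have "0 \<le> Re (hform 3 (kernel3 a b c x y z) v)"
    using assms(1) by (simp add: psd_kernel_def)
  ultimately show ?thesis using B by (simp add: zero_le_mult_iff)
qed

text \<open>A positive determinant makes the matrix definite, so \<open>P\<close> holds for it and
  for its image, whose determinant is then nonnegative. Negative determinants are treated by the
  same chain from the image back to the matrix.\<close>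

lemma sign_preserver_det3:
  assumes P: "P = psd_kernel \<or> P = pd_kernel"
    and n: "n \<ge> 3" and g: "sign_preserver P n \<Omega> g" and R: "\<real> \<subseteq> \<Omega>" and "\<And>z. z \<in> \<Omega> \<Longrightarrow> cnj z \<in> \<Omega>"
  shows "det3_sign_preserver \<Omega> g (\<lambda>t. Re (g (of_real t)))"
proof -
  define \<phi> where "\<phi> t = Re (g (of_real t))" for t
  have incr: "real_positive_increasing g"
    using P g n R psd_sign_preserver_increasing[of n \<Omega> g] pd_sign_preserver_increasing[of n \<Omega> g] by auto
  then have \<phi>: "g (of_real t) = of_real (\<phi> t)" "0 < \<phi> t" if "t > 0" for t
    using that unfolding real_positive_increasing_def \<phi>_def by blast+
  have mem: "of_real t \<in> \<Omega>" for t using R by auto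
  have mem0: "0 \<in> \<Omega>" using mem[of 0] by simp
  have P_psd: "P 3 M \<Longrightarrow> psd_kernel 3 M" and P_pd: "pd_kernel 3 M \<Longrightarrow> P 3 M" for M
    using P pd_kernel_imp_psd_kernel by blast+
  have kernel_mem: "kernel3 a b c x y z i j \<in> \<Omega>"
    if "x \<in> \<Omega>" "y \<in> \<Omega>" "z \<in> \<Omega>" "i < 3" "j < 3" for a b c x y z i j
    using that assms(5) mem by (auto simp: kernel3_def less_3_cases)
  have K: "P 3 (kernel3 a b c x y z) \<longleftrightarrow> P 3 (\<lambda>i j. g (kernel3 a b c x y z i j))"
    if "x \<in> \<Omega>" "y \<in> \<Omega>" "z \<in> \<Omega>" "c > 0" for a b c x y z
    using that kernel_mem
    by (intro sign_preserver_3[OF P n g R incr, of _ c]) (auto simp: hermitian_kernel3, simp add: kernel3_def)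
  \<comment> \<open>With a diagonal exceeding \<open>cmod x\<close> there is a definite matrix
    containing \<open>x\<close>; its image is semidefinite, hence Hermitian.\<close>
  have cnj: "g (cnj x) = cnj (g x)" if "x \<in> \<Omega>" for x
  proof -
    define s where "s = cmod x + 1"
    have s: "s > 0" by (simp add: s_def add_nonneg_pos)
    have less: "(cmod x)\<^sup>2 < s * s"
      unfolding power2_eq_square[symmetric] by (rule power_strict_mono) (simp_all add: s_def)
    have "det3 s s s x 0 0 = s * (s * s - (cmod x)\<^sup>2)" by (simp add: det3_def algebra_simps)
    then have "pd_kernel 3 (kernel3 s s s x 0 0)"
      using less s by (intro pd_kernel3) auto
    then have "psd_kernel 3 (\<lambda>i j. g (kernel3 s s s x 0 0 i j))"
      using K[OF that mem0 mem0 s] P_psd P_pd by blast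
    then have "hermitian_kernel 3 (\<lambda>i j. g (kernel3 s s s x 0 0 i j))"
      by (simp add: psd_kernel_def)
    then have "g (kernel3 s s s x 0 0 1 0) = cnj (g (kernel3 s s s x 0 0 0 1))"
      by (rule hermitian_kernelD) simp_all
    then show ?thesis by (simp add: kernel3_def)
  qed
  have image: "g (kernel3 a b c x y z i j) = kernel3 (\<phi> a) (\<phi> b) (\<phi> c) (g x) (g y) (g z) i j"
    if "a > 0" "b > 0" "c > 0" "x \<in> \<Omega>" "y \<in> \<Omega>" "z \<in> \<Omega>" "i < 3" "j < 3" for a b c x y z i j
    using that by (auto simp: kernel3_def less_3_cases \<phi> cnj)
  have K': "P 3 (kernel3 a b c x y z) \<longleftrightarrow> P 3 (kernel3 (\<phi> a) (\<phi> b) (\<phi> c) (g x) (g y) (g z))"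
    if "a > 0" "b > 0" "c > 0" "x \<in> \<Omega>" "y \<in> \<Omega>" "z \<in> \<Omega>" for a b c x y z
  proof -
    have "P 3 (\<lambda>i j. g (kernel3 a b c x y z i j)) =
        P 3 (kernel3 (\<phi> a) (\<phi> b) (\<phi> c) (g x) (g y) (g z))"
      using P
    proof (elim disjE)
      assume "P = psd_kernel"
      then show ?thesis by (simp only:) (rule kernel_cong(2), rule image[OF that])
    next
      assume "P = pd_kernel"
      then show ?thesis by (simp only:) (rule kernel_cong(3), rule image[OF that])
    qed
    then show ?thesis using K[OF that(4-6,3)] by simp
  qed
  show ?thesis
    unfolding \<phi>_def[symmetric]
  proof
    show "\<real> \<subseteq> \<Omega>" by (fact R)
    show "g (of_real t) = of_real (\<phi> t)" "\<phi> t > 0" if "t > 0" for t using \<phi> that by auto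
    show "\<phi> s < \<phi> t" if "0 < s" "s < t" for s t
      using incr that unfolding real_positive_increasing_def \<phi>_def by blast
    fix a b c :: real and x y z :: complex
    assume pos: "a > 0" "b > 0" "c > 0" and \<Omega>: "x \<in> \<Omega>" "y \<in> \<Omega>" "z \<in> \<Omega>"
      and minor: "(cmod x)\<^sup>2 < a * b" "(cmod (g x))\<^sup>2 < \<phi> a * \<phi> b"
    show "det3 (\<phi> a) (\<phi> b) (\<phi> c) (g x) (g y) (g z) \<ge> 0" if "det3 a b c x y z > 0"
      using psd_kernel3_det[OF _ minor(2)] P_psd P_pd pd_kernel3[OF pos(1) minor(1) that]
        K'[OF pos \<Omega>] by blast
    show "det3 (\<phi> a) (\<phi> b) (\<phi> c) (g x) (g y) (g z) \<le> 0" if "det3 a b c x y z < 0"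
    proof (rule ccontr)
      assume "\<not> ?thesis"
      then have "pd_kernel 3 (kernel3 (\<phi> a) (\<phi> b) (\<phi> c) (g x) (g y) (g z))"
        using \<phi>(2)[OF pos(1)] minor(2) by (intro pd_kernel3) auto
      then have "det3 a b c x y z \<ge> 0"
        using psd_kernel3_det[OF _ minor(1)] P_psd P_pd K'[OF pos \<Omega>] by blast
      then show False using that by simp
    qed
  qed
qed

section \<open>Automorphisms and the classification\<close>

text \<open>A field homomorphism fixes the rationals; continuity makes the set of fixed reals
  closed, and the rationals are dense.\<close>

lemma continuous_automorphism_of_real:
  fixes \<sigma> :: "'a :: real_normed_field \<Rightarrow> 'a"
  assumes "continuous_field_automorphism \<sigma>"
  shows "\<sigma> (of_real x) = of_real x"
proof -
  interpret field_hom \<sigma> using assms by (simp add: continuous_field_automorphism_def)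
  have "continuous_on UNIV (\<lambda>x. \<sigma> (of_real x))"
    using assms unfolding continuous_field_automorphism_def
    by (intro continuous_on_compose2[of UNIV \<sigma> UNIV of_real] continuous_intros) auto
  then have "closed {x. \<sigma> (of_real x) = of_real x}"
    by (intro closed_Collect_eq continuous_intros)
  moreover have "\<rat> \<subseteq> {x. \<sigma> (of_real x) = of_real x}"
  proof
    fix x :: real assume "x \<in> \<rat>"
    then obtain a b where x: "x = of_int a / of_int b" by (rule Rats_cases')
    show "x \<in> {x. \<sigma> (of_real x) = of_real x}"
      unfolding x mem_Collect_eq of_real_divide of_real_of_int_eq hom_div hom_of_int ..
  qed
  ultimately have "closure \<rat> \<subseteq> {x. \<sigma> (of_real x) = of_real x}"
    by (rule closure_minimal[rotated])
  then show ?thesis by (auto simp: Rats_closure_real)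
qed

lemma continuous_automorphism_id: "continuous_field_automorphism (\<lambda>x. x)"
proof -
  have "field_hom (\<lambda>x :: 'a. x)" by unfold_locales auto
  then show ?thesis
    unfolding continuous_field_automorphism_def
    by (auto intro: bij_betwI[of _ _ _ "\<lambda>x. x"])
qed

lemma continuous_automorphism_cnj: "continuous_field_automorphism cnj"
proof -
  have "field_hom cnj" by unfold_locales auto
  moreover have "bij cnj" by (rule o_bij[of cnj]) (auto simp: fun_eq_iff)
  ultimately show ?thesis
    unfolding continuous_field_automorphism_def by (auto intro: continuous_intros)
qed

lemma continuous_automorphism_real:
  fixes \<sigma> :: "real \<Rightarrow> real"
  shows "continuous_field_automorphism \<sigma> \<longleftrightarrow> \<sigma> = (\<lambda>x. x)"
  using continuous_automorphism_of_real[of \<sigma>] continuous_automorphism_id by fastforce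

text \<open>Fixing the reals, \<open>\<sigma>\<close> is determined by \<open>\<sigma> \<i>\<close>,
  which is a square root of -1.\<close>

lemma continuous_automorphism_complex:
  "continuous_field_automorphism \<sigma> \<longleftrightarrow> \<sigma> = (\<lambda>z. z) \<or> \<sigma> = cnj"
proof
  assume \<sigma>: "continuous_field_automorphism \<sigma>"
  interpret field_hom \<sigma> using \<sigma> by (simp add: continuous_field_automorphism_def)
  have form: "\<sigma> z = of_real (Re z) + \<sigma> \<i> * of_real (Im z)" for z
    using arg_cong[OF complex_eq[of z], of \<sigma>]
    unfolding hom_add hom_mult continuous_automorphism_of_real[OF \<sigma>] .
  have "\<sigma> \<i> = \<i> \<or> \<sigma> \<i> = - \<i>"
  proof -
    have "\<sigma> \<i> * \<sigma> \<i> = - 1"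
      using continuous_automorphism_of_real[OF \<sigma>, of "-1"] by (simp flip: hom_mult)
    then have "(\<sigma> \<i> - \<i>) * (\<sigma> \<i> + \<i>) = 0" by (simp add: algebra_simps)
    then show ?thesis by (auto simp: eq_neg_iff_add_eq_0)
  qed
  then show "\<sigma> = (\<lambda>z. z) \<or> \<sigma> = cnj"
  proof
    assume "\<sigma> \<i> = \<i>"
    then have "\<sigma> z = z" for z
      unfolding form[of z] by (simp add: complex_eq_iff)
    then show ?thesis by blast
  next
    assume "\<sigma> \<i> = - \<i>"
    then have "\<sigma> z = cnj z" for z
      unfolding form[of z] by (simp add: complex_eq_iff)
    then show ?thesis by blast
  qed
qed (use continuous_automorphism_id continuous_automorphism_cnj in blast)

lemma positive_multiple_real_iff:
  fixes f :: "real \<Rightarrow> real"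
  shows "positive_multiple_of_continuous_automorphism f \<longleftrightarrow> (\<exists>c>0. \<forall>x. f x = c * x)"
  by (simp add: positive_multiple_of_continuous_automorphism_def continuous_automorphism_real)

lemma positive_multiple_complex_iff:
  "positive_multiple_of_continuous_automorphism g \<longleftrightarrow>
     (\<exists>c::real. c > 0 \<and> ((\<forall>z. g z = of_real c * z) \<or> (\<forall>z. g z = of_real c * cnj z)))"
  unfolding positive_multiple_of_continuous_automorphism_def continuous_automorphism_complex
    scaleR_conv_of_real
  by blast

section \<open>Scalings and conjugation preserve positivity\<close>

lemma hform_scale: "hform n (\<lambda>i j. c * M i j) v = c * hform n M v"
  by (simp add: hform_def sum_distrib_left mult.assoc)

lemma kernel_scale:
  fixes c :: real
  assumes "c > 0"
  shows "psd_kernel n (\<lambda>i j. of_real c * M i j) \<longleftrightarrow> psd_kernel n M"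
    and "pd_kernel n (\<lambda>i j. of_real c * M i j) \<longleftrightarrow> pd_kernel n M"
proof -
  have "hermitian_kernel n (\<lambda>i j. of_real c * M i j) \<longleftrightarrow> hermitian_kernel n M"
    using assms by (simp add: hermitian_kernel_def)
  then show "psd_kernel n (\<lambda>i j. of_real c * M i j) \<longleftrightarrow> psd_kernel n M"
    "pd_kernel n (\<lambda>i j. of_real c * M i j) \<longleftrightarrow> pd_kernel n M"
    using assms
    by (simp_all add: psd_kernel_def pd_kernel_def hform_scale zero_le_mult_iff zero_less_mult_iff)
qed

lemma hform_cnj: "hform n (\<lambda>i j. cnj (M i j)) v = cnj (hform n M (\<lambda>i. cnj (v i)))"
  by (simp add: hform_def)

text \<open>By \<open>hform_cnj\<close>, conjugating the matrix amounts to conjugating the test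
  vector, up to a conjugation of the value that leaves its real part alone.\<close>

lemma kernel_cnjI:
  "psd_kernel n M \<Longrightarrow> psd_kernel n (\<lambda>i j. cnj (M i j))"
  "pd_kernel n M \<Longrightarrow> pd_kernel n (\<lambda>i j. cnj (M i j))"
proof -
  have "hermitian_kernel n (\<lambda>i j. cnj (M i j))" if "hermitian_kernel n M"
    unfolding hermitian_kernel_def using hermitian_kernelD[OF that] by (metis complex_cnj_cnj)
  then show "psd_kernel n M \<Longrightarrow> psd_kernel n (\<lambda>i j. cnj (M i j))"
    "pd_kernel n M \<Longrightarrow> pd_kernel n (\<lambda>i j. cnj (M i j))"
    by (simp_all add: psd_kernel_def pd_kernel_def hform_cnj)
qed

lemma kernel_cnj:
  "psd_kernel n (\<lambda>i j. cnj (M i j)) \<longleftrightarrow> psd_kernel n M"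
  "pd_kernel n (\<lambda>i j. cnj (M i j)) \<longleftrightarrow> pd_kernel n M"
  using kernel_cnjI[of n M] kernel_cnjI[of n "\<lambda>i j. cnj (M i j)"] by auto

lemma positive_map_mat_complex:
  assumes A: "A \<in> carrier_mat n n"
  shows "positive_semidefinite (map_mat g A) \<longleftrightarrow> psd_kernel n (\<lambda>i j. g (A $$ (i, j)))"
    and "positive_definite (map_mat g A) \<longleftrightarrow> pd_kernel n (\<lambda>i j. g (A $$ (i, j)))"
proof -
  have "map_mat g A \<in> carrier_mat n n" using A by simp
  note iffs = positive_semidefinite_complex[OF this] positive_definite_complex[OF this]
  show "positive_semidefinite (map_mat g A) \<longleftrightarrow> psd_kernel n (\<lambda>i j. g (A $$ (i, j)))"
    "positive_definite (map_mat g A) \<longleftrightarrow> pd_kernel n (\<lambda>i j. g (A $$ (i, j)))"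
    unfolding iffs by (rule kernel_cong; use A in simp)+
qed

lemma positive_map_mat_real:
  assumes A: "A \<in> carrier_mat n n"
  shows "positive_semidefinite (map_mat f A) \<longleftrightarrow>
      psd_kernel n (\<lambda>i j. complex_of_real (f (A $$ (i, j))))"
    and "positive_definite (map_mat f A) \<longleftrightarrow>
      pd_kernel n (\<lambda>i j. complex_of_real (f (A $$ (i, j))))"
proof -
  have "map_mat f A \<in> carrier_mat n n" using A by simp
  note iffs = positive_semidefinite_real[OF this] positive_definite_real[OF this]
  show "positive_semidefinite (map_mat f A) \<longleftrightarrow>
      psd_kernel n (\<lambda>i j. complex_of_real (f (A $$ (i, j))))"
    "positive_definite (map_mat f A) \<longleftrightarrow>
      pd_kernel n (\<lambda>i j. complex_of_real (f (A $$ (i, j))))"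
    unfolding iffs by (rule kernel_cong; use A in simp)+
qed

lemma scaling_sign_preserver_real:
  assumes "c > 0" "\<And>x. f x = c * (x :: real)"
  shows "psd_sign_preserver n UNIV f" "pd_sign_preserver n UNIV f"
  unfolding psd_sign_preserver_def pd_sign_preserver_def
  by (intro ballI impI,
      simp only: positive_map_mat_real positive_semidefinite_real positive_definite_real assms(2)
        of_real_mult kernel_scale[OF assms(1)])+

lemma scaling_sign_preserver_complex:
  assumes "c > 0" "(\<forall>z. g z = of_real c * z) \<or> (\<forall>z. g z = of_real c * cnj z)"
  shows "psd_sign_preserver n UNIV g" "pd_sign_preserver n UNIV g"
proof -
  have "psd_kernel n (\<lambda>i j. g (M i j)) = psd_kernel n M \<and>
      pd_kernel n (\<lambda>i j. g (M i j)) = pd_kernel n M" for M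
    using assms(2)
  proof (elim disjE)
    assume "\<forall>z. g z = of_real c * z"
    then show ?thesis by (simp add: kernel_scale[OF assms(1)])
  next
    assume "\<forall>z. g z = of_real c * cnj z"
    then show ?thesis by (simp add: kernel_scale[OF assms(1)] kernel_cnj)
  qed
  then show "psd_sign_preserver n UNIV g" "pd_sign_preserver n UNIV g"
    unfolding psd_sign_preserver_def pd_sign_preserver_def
    by (auto simp only: positive_map_mat_complex positive_semidefinite_complex
        positive_definite_complex)
qed

lemma sign_preserver_real_scaling:
  assumes P: "P = psd_kernel \<or> P = pd_kernel" and n: "n \<ge> 3"
    and f: "sign_preserver P n \<real> (\<lambda>z. of_real (f (Re z)))"
  shows "\<exists>c>0. \<forall>x. f x = c * x"
proof -
  interpret det3_sign_preserver \<real> "\<lambda>z. of_real (f (Re z))"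
    "\<lambda>t. Re (of_real (f (Re (complex_of_real t))))"
    by (rule sign_preserver_det3[OF P n f]) (auto simp: Reals_cnj_iff)
  have c: "f 1 > 0" using pos[of 1] by simp
  have "f x = f 1 * x" for x
  proof -
    \<comment> \<open>Multiplying by 1 reaches negative \<open>x\<close> as well, where
      \<open>linear\<close> does not apply.\<close>
    have "f x * f 1 = (f 1)\<^sup>2 * x"
      using Re_mult_preserving[of "of_real x" 1] by simp
    then have "f x * f 1 = f 1 * x * f 1"
      by (simp only: power2_eq_square mult_ac)
    then show ?thesis using c by simp
  qed
  then show ?thesis using c by blast
qed

text \<open>The factor 1 determines \<open>Re (g z)\<close>. Then \<open>g \<i>\<close> has real
  part 0 and modulus \<open>c\<close>, so the factor \<open>\<i>\<close> determines
  \<open>Im (g z)\<close>; the sign of \<open>Im (g \<i>)\<close> separates the identity from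
  conjugation.\<close>

lemma sign_preserver_complex_scaling:
  assumes P: "P = psd_kernel \<or> P = pd_kernel" and n: "n \<ge> 3"
    and g: "sign_preserver P n UNIV g"
  shows "\<exists>c::real. c > 0 \<and> ((\<forall>z. g z = of_real c * z) \<or> (\<forall>z. g z = of_real c * cnj z))"
proof -
  interpret det3_sign_preserver UNIV g "\<lambda>t. Re (g (of_real t))"
    by (rule sign_preserver_det3[OF P n g]) auto
  define c where "c = Re (g 1)"
  have c: "c > 0" using pos[of 1] by (simp add: c_def)
  have g1: "g 1 = of_real c" using g_of_real[of 1] by (simp add: c_def)
  have Re_mult: "Re (g z * g w) = c\<^sup>2 * Re (z * w)" for z w
    using Re_mult_preserving[of z w] by (simp add: c_def)
  have Re: "Re (g z) = c * Re z" for z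
  proof -
    have "c * Re (g z) = c * (c * Re z)"
      using Re_mult[of z 1] by (simp add: g1 power2_eq_square mult_ac)
    then show ?thesis using c by simp
  qed
  have "cmod (g \<i>) = c"
    using norm_preserving[of \<i>] by (simp add: c_def)
  moreover have Re_i: "Re (g \<i>) = 0" using Re[of \<i>] by simp
  ultimately have "\<bar>Im (g \<i>)\<bar> = c" by (simp add: cmod_def)
  then consider "Im (g \<i>) = c" | "Im (g \<i>) = - c" by linarith
  then show ?thesis
  proof cases
    case 1
    have "Im (g z) = c * Im z" for z
    proof -
      have "c * Im (g z) = c * (c * Im z)"
        using Re_mult[of z \<i>] by (simp add: Re_i 1 power2_eq_square mult_ac)
      then show ?thesis using c by simp
    qed
    then have "\<forall>z. g z = of_real c * z" by (simp add: complex_eq_iff Re)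
    then show ?thesis using c by blast
  next
    case 2
    have "Im (g z) = - c * Im z" for z
    proof -
      have "c * Im (g z) = c * (- c * Im z)"
        using Re_mult[of z \<i>] by (simp add: Re_i 2 power2_eq_square mult_ac)
      then show ?thesis using c by (metis mult_left_cancel less_irrefl)
    qed
    then have "\<forall>z. g z = of_real c * cnj z" by (simp add: complex_eq_iff Re)
    then show ?thesis using c by blast
  qed
qed

theorem theorem1p8:
  fixes n :: nat and f :: "real \<Rightarrow> real" and g :: "complex \<Rightarrow> complex"
  assumes "n \<ge> 3"
  shows "((pd_sign_preserver n UNIV f \<longleftrightarrow> psd_sign_preserver n UNIV f) \<and>
          (psd_sign_preserver n UNIV f \<longleftrightarrow> positive_multiple_of_continuous_automorphism f) \<and>
          (positive_multiple_of_continuous_automorphism f \<longleftrightarrow>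
             (\<exists>c::real. c > 0 \<and> (\<forall>x. f x = c * x))))
       \<and> ((pd_sign_preserver n UNIV g \<longleftrightarrow> psd_sign_preserver n UNIV g) \<and>
          (psd_sign_preserver n UNIV g \<longleftrightarrow> positive_multiple_of_continuous_automorphism g) \<and>
          (positive_multiple_of_continuous_automorphism g \<longleftrightarrow>
             (\<exists>c::real. c > 0 \<and>
                ((\<forall>z. g z = complex_of_real c * z) \<or>
                 (\<forall>z. g z = complex_of_real c * cnj z)))))"
proof -
  \<comment> \<open>Each preserver property is compared with the explicit scalings, which makes the
    two properties equivalent to each other.\<close>
  have "psd_sign_preserver n UNIV f \<longleftrightarrow> (\<exists>c>0. \<forall>x. f x = c * x)"
    using sign_preserver_real_scaling[of psd_kernel n f] psd_sign_preserver_real[of n f]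
      scaling_sign_preserver_real(1)[of _ f n] assms by blast
  moreover have "pd_sign_preserver n UNIV f \<longleftrightarrow> (\<exists>c>0. \<forall>x. f x = c * x)"
    using sign_preserver_real_scaling[of pd_kernel n f] pd_sign_preserver_real[of n f]
      scaling_sign_preserver_real(2)[of _ f n] assms by blast
  moreover have "psd_sign_preserver n UNIV g \<longleftrightarrow> (\<exists>c::real. c > 0 \<and>
      ((\<forall>z. g z = complex_of_real c * z) \<or> (\<forall>z. g z = complex_of_real c * cnj z)))"
    using sign_preserver_complex_scaling[of psd_kernel n g] psd_sign_preserver_complex[of n g]
      scaling_sign_preserver_complex(1)[of _ g n] assms by blast
  moreover have "pd_sign_preserver n UNIV g \<longleftrightarrow> (\<exists>c::real. c > 0 \<and>
      ((\<forall>z. g z = complex_of_real c * z) \<or> (\<forall>z. g z = complex_of_real c * cnj z)))"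
    using sign_preserver_complex_scaling[of pd_kernel n g] pd_sign_preserver_complex[of n g]
      scaling_sign_preserver_complex(2)[of _ g n] assms by blast
  ultimately show ?thesis
    unfolding positive_multiple_real_iff positive_multiple_complex_iff by blast
qed

end
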